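(* Let $Q$ be a finite quiver on $k$ vertices and $V=\mathbb{C}^k\subset\mathbb{C}Q$ the vertex subalgebra. The relative Karoubi complex $\mathrm{dR}^0_V\,\mathbb{C}Q\xrightarrow{d}\mathrm{dR}^1_V\,\mathbb{C}Q\xrightarrow{d}\mathrm{dR}^2_V\,\mathbb{C}Q\xrightarrow{d}\cdots$ is acyclic; in particular its cohomology satisfies $$H^0_{dR}\,\mathbb{C}Q\simeq V,\qquad H^n_{dR}\,\mathbb{C}Q\simeq0\quad\text{for all }n\ge1.$$
   Context: A quiver $Q$ is a finite directed graph with vertices $v_1,\dots,v_k$ (loops, multiple arrows and oriented cycles allowed). The path algebra $A=\mathbb{C}Q$ has as basis all oriented paths, including the length-zero vertex idempotents $e_1,\dots,e_k$, with multiplication by concatenation; $V=\bigoplus_i\mathbb{C}e_i\cong\mathbb{C}^k$. Relative forms: $\Omega^n_VA=A\otimes_V\overline{A}_V\otimes_V\cdots\otimes_V\overline{A}_V$ ($n$ factors $\overline{A}_V=A/V$, the cokernel of $V\subset A$ as $V$-bimodules), where $(a_0,\dots,a_n)$ represents $a_0da_1\cdots da_n$. $\Omega^\bullet_VA$ is a differential graded algebra with product $(a_0,\dots,a_n)(a_{n+1},\dots,a_m)=\sum_{i=0}^n(-1)^{n-i}(a_0,\dots,a_{i-1},a_ia_{i+1},a_{i+2},\dots,a_m)$ and differential $d(a_0,\dots,a_n)=(1,a_0,\dots,a_n)$. Relative Karoubi complex: $\mathrm{dR}^n_VA=\Omega^n_VA\big/\sum_{i=0}^n[\Omega^i_VA,\Omega^{n-i}_VA]$,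 where brackets denote (the linear spans of) supercommutators with respect to the grading, with the induced differential $d$. The relative de Rham cohomology $H^n_{dR}A$ is the cohomology of this complex. "Acyclic" means cohomology $V$ in degree $0$ and zero in positive degrees. *)

theory Defs
  imports
    "HOL-Library.Poly_Mapping"
    "HOL-Algebra.Module"
    "HOL-Algebra.AbelCoset"
    "HOL-Algebra.Algebraic_Closure_Type"
    "Graph_Theory.Arc_Walk"
begin

section \<open>Modules: spans, quotients, homomorphisms\<close>

definition module_span :: "('r, 'a) ring_scheme \<Rightarrow> ('r, 'm, 'b) module_scheme \<Rightarrow> 'm set \<Rightarrow> 'm set"
  where "module_span R M S = (\<lambda>N. submodule N R M) hull S"

text \<open>
  The quotient of the module \<open>M\<close> by a submodule \<open>N\<close>, with the cosets of \<open>N\<close> as elements.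
  As for quotient rings in the library, operations on cosets are defined by performing the operation
  on all representatives.  A module record is also a ring record; the multiplicative fields play no
  role for modules and are left undefined.
\<close>

definition quot_module :: "('r, 'm, 'b) module_scheme \<Rightarrow> 'm set \<Rightarrow> ('r, 'm set) module"
  where "quot_module M N =
    \<lparr>carrier = a_rcosets\<^bsub>M\<^esub> N, monoid.mult = undefined, one = undefined,
     zero = N, add = set_add M,
     module.smult = (\<lambda>c S. \<Union>x\<in>S. N +>\<^bsub>M\<^esub> (c \<odot>\<^bsub>M\<^esub> x))\<rparr>"

text \<open>The map into the quotient of \<open>M\<close> by \<open>N\<close> induced by a map \<open>f\<close> on representatives with values in \<open>M\<close>.\<close>

definition induced_map ::
    "('r, 'm, 'b) module_scheme \<Rightarrow> 'm set \<Rightarrow> ('x \<Rightarrow> 'm) \<Rightarrow> 'x set \<Rightarrow> 'm set"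
  where "induced_map M N f S = (\<Union>x\<in>S. N +>\<^bsub>M\<^esub> f x)"

definition linear_maps ::
    "('r, 'a) ring_scheme \<Rightarrow> ('r, 'm, 'b) module_scheme \<Rightarrow> ('r, 'n, 'c) module_scheme \<Rightarrow> ('m \<Rightarrow> 'n) set"
  where "linear_maps R M N =
    {f \<in> carrier M \<rightarrow> carrier N.
      (\<forall>x\<in>carrier M. \<forall>y\<in>carrier M. f (x \<oplus>\<^bsub>M\<^esub> y) = f x \<oplus>\<^bsub>N\<^esub> f y) \<and>
      (\<forall>c\<in>carrier R. \<forall>x\<in>carrier M. f (c \<odot>\<^bsub>M\<^esub> x) = c \<odot>\<^bsub>N\<^esub> f x)}"

definition linear_isos ::
    "('r, 'a) ring_scheme \<Rightarrow> ('r, 'm, 'b) module_scheme \<Rightarrow> ('r, 'n, 'c) module_scheme \<Rightarrow> ('m \<Rightarrow> 'n) set"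
  where "linear_isos R M N = {f \<in> linear_maps R M N. bij_betw f (carrier M) (carrier N)}"

definition modules_isomorphic ::
    "('r, 'a) ring_scheme \<Rightarrow> ('r, 'm, 'b) module_scheme \<Rightarrow> ('r, 'n, 'c) module_scheme \<Rightarrow> bool"
  where "modules_isomorphic R M N \<longleftrightarrow> linear_isos R M N \<noteq> {}"

section \<open>Cochain complexes in degrees \<open>n \<ge> 0\<close>\<close>

definition cochain_complex ::
    "('r, 'a) ring_scheme \<Rightarrow> (nat \<Rightarrow> ('r, 'm, 'b) module_scheme) \<Rightarrow> (nat \<Rightarrow> 'm \<Rightarrow> 'm) \<Rightarrow> bool"
  where "cochain_complex R C d \<longleftrightarrow>
    (\<forall>n. module R (C n) \<and> d n \<in> linear_maps R (C n) (C (Suc n)) \<and>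
      (\<forall>x\<in>carrier (C n). d (Suc n) (d n x) = \<zero>\<^bsub>C (Suc (Suc n))\<^esub>))"

definition cocycles ::
    "(nat \<Rightarrow> ('r, 'm, 'b) module_scheme) \<Rightarrow> (nat \<Rightarrow> 'm \<Rightarrow> 'm) \<Rightarrow> nat \<Rightarrow> ('r, 'm, 'b) module_scheme"
  where "cocycles C d n = (C n)\<lparr>carrier := {x \<in> carrier (C n). d n x = \<zero>\<^bsub>C (Suc n)\<^esub>}\<rparr>"

definition coboundaries ::
    "(nat \<Rightarrow> ('r, 'm, 'b) module_scheme) \<Rightarrow> (nat \<Rightarrow> 'm \<Rightarrow> 'm) \<Rightarrow> nat \<Rightarrow> 'm set"
  where "coboundaries C d n = (case n of 0 \<Rightarrow> {\<zero>\<^bsub>C 0\<^esub>} | Suc m \<Rightarrow> d m ` carrier (C m))"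

definition cohomology ::
    "(nat \<Rightarrow> ('r, 'm, 'b) module_scheme) \<Rightarrow> (nat \<Rightarrow> 'm \<Rightarrow> 'm) \<Rightarrow> nat \<Rightarrow> ('r, 'm set) module"
  where "cohomology C d n = quot_module (cocycles C d n) (coboundaries C d n)"

section \<open>Free complex vector spaces\<close>

abbreviation complex_field :: "complex ring"
  where "complex_field \<equiv> ring_of_type_algebra"

definition scale :: "complex \<Rightarrow> ('x \<Rightarrow>\<^sub>0 complex) \<Rightarrow> ('x \<Rightarrow>\<^sub>0 complex)"
  where "scale c f = Poly_Mapping.map ((*) c) f"

abbreviation basis :: "'x \<Rightarrow> ('x \<Rightarrow>\<^sub>0 complex)"
  where "basis x \<equiv> Poly_Mapping.single x 1"

definition lin_ext :: "('x \<Rightarrow> 'y \<Rightarrow>\<^sub>0 complex) \<Rightarrow> ('x \<Rightarrow>\<^sub>0 complex) \<Rightarrow> ('y \<Rightarrow>\<^sub>0 complex)"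
  where "lin_ext \<phi> f = (\<Sum>x\<in>Poly_Mapping.keys f. scale (Poly_Mapping.lookup f x) (\<phi> x))"

definition bilin_ext ::
    "('x \<Rightarrow> 'y \<Rightarrow> 'z \<Rightarrow>\<^sub>0 complex) \<Rightarrow> ('x \<Rightarrow>\<^sub>0 complex) \<Rightarrow> ('y \<Rightarrow>\<^sub>0 complex) \<Rightarrow> ('z \<Rightarrow>\<^sub>0 complex)"
  where "bilin_ext \<phi> f g = lin_ext (\<lambda>x. lin_ext (\<phi> x) g) f"

definition free_module :: "'x set \<Rightarrow> (complex, 'x \<Rightarrow>\<^sub>0 complex) module"
  where "free_module S =
    \<lparr>carrier = {f. Poly_Mapping.keys f \<subseteq> S}, monoid.mult = undefined, one = undefined,
     zero = 0, add = (+), module.smult = scale\<rparr>"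

section \<open>The path algebra of a quiver\<close>

text \<open>
  A path is a triple of its source, its list of arrows, and its target; the endpoints
  distinguish the paths of length zero.  Products are read from left to right:
  \<open>pq\<close> is \<open>p\<close> followed by \<open>q\<close>, and is zero if \<open>q\<close> does not start where \<open>p\<close> ends.
\<close>

type_synonym ('v, 'e) path = "'v \<times> 'e list \<times> 'v"

definition quiver_paths :: "('v, 'e) pre_digraph \<Rightarrow> ('v, 'e) path set"
  where "quiver_paths Q = {(u, es, w). pre_digraph.awalk Q u es w}"

fun path_mult :: "('v, 'e) path \<Rightarrow> ('v, 'e) path \<Rightarrow> ('v, 'e) path \<Rightarrow>\<^sub>0 complex"
  where "path_mult (u, es, w) (u', es', w') = (if w = u' then basis (u, es @ es', w') else 0)"

definition path_algebra :: "('v, 'e) pre_digraph \<Rightarrow> (complex, ('v, 'e) path \<Rightarrow>\<^sub>0 complex) module"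
  where "path_algebra Q =
    \<lparr>carrier = {f. Poly_Mapping.keys f \<subseteq> quiver_paths Q}, monoid.mult = bilin_ext path_mult,
     one = (\<Sum>v\<in>verts Q. basis (v, [], v)),
     zero = 0, add = (+), module.smult = scale\<rparr>"

definition vertex_subalgebra :: "('v, 'e) pre_digraph \<Rightarrow> (('v, 'e) path \<Rightarrow>\<^sub>0 complex) set"
  where "vertex_subalgebra Q = {f. Poly_Mapping.keys f \<subseteq> (\<lambda>v. (v, [], v)) ` verts Q}"

section \<open>Relative noncommutative forms\<close>

text \<open>
  In this section \<open>A\<close> is a unital associative complex algebra, not necessarily commutative,
  given as a module record whose ring fields carry the multiplication, and \<open>V\<close> is (the carrier of) a
  subalgebra.  The list \<open>[a\<^sub>0, \<dots>, a\<^sub>n]\<close> of elements of \<open>A\<close> stands for the symbol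
  \<open>(a\<^sub>0, \<dots>, a\<^sub>n)\<close>, that is \<open>a\<^sub>0 da\<^sub>1 \<cdots> da\<^sub>n\<close>.
\<close>

definition symbols :: "(complex, 'a, 'b) module_scheme \<Rightarrow> nat \<Rightarrow> 'a list set"
  where "symbols A n = {as. length as = Suc n \<and> set as \<subseteq> carrier A}"

abbreviation free_forms :: "(complex, 'a, 'b) module_scheme \<Rightarrow> nat \<Rightarrow> (complex, 'a list \<Rightarrow>\<^sub>0 complex) module"
  where "free_forms A n \<equiv> free_module (symbols A n)"

text \<open>
  The defining relations of \<open>A \<otimes>\<^sub>V A/V \<otimes>\<^sub>V \<cdots> \<otimes>\<^sub>V A/V\<close> (with \<open>n\<close> factors \<open>A/V\<close>)
  as a quotient of the vector space with basis \<open>symbols A n\<close>: additivity and homogeneity in every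
  entry, \<open>V\<close>-balancedness at every tensor sign, and vanishing of the elements of \<open>V\<close> in
  every entry but the first.
\<close>

definition form_relators :: "(complex, 'a, 'b) module_scheme \<Rightarrow> 'a set \<Rightarrow> nat \<Rightarrow> ('a list \<Rightarrow>\<^sub>0 complex) set"
  where "form_relators A V n =
      {basis (xs @ (a \<oplus>\<^bsub>A\<^esub> b) # ys) - basis (xs @ a # ys) - basis (xs @ b # ys) | xs a b ys.
        xs @ a # ys \<in> symbols A n \<and> b \<in> carrier A}
    \<union> {basis (xs @ (c \<odot>\<^bsub>A\<^esub> a) # ys) - scale c (basis (xs @ a # ys)) | xs c a ys.
        xs @ a # ys \<in> symbols A n}
    \<union> {basis (xs @ (a \<otimes>\<^bsub>A\<^esub> v) # b # ys) - basis (xs @ a # (v \<otimes>\<^bsub>A\<^esub> b) # ys) | xs a v b ys.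
        xs @ a # b # ys \<in> symbols A n \<and> v \<in> V}
    \<union> {basis (xs @ v # ys) | xs v ys.
        xs @ v # ys \<in> symbols A n \<and> xs \<noteq> [] \<and> v \<in> V}"

definition form_relations :: "(complex, 'a, 'b) module_scheme \<Rightarrow> 'a set \<Rightarrow> nat \<Rightarrow> ('a list \<Rightarrow>\<^sub>0 complex) set"
  where "form_relations A V n = module_span complex_field (free_forms A n) (form_relators A V n)"

definition forms :: "(complex, 'a, 'b) module_scheme \<Rightarrow> 'a set \<Rightarrow> nat \<Rightarrow> (complex, ('a list \<Rightarrow>\<^sub>0 complex) set) module"
  where "forms A V n = quot_module (free_forms A n) (form_relations A V n)"

text \<open>
  \<open>contract A i [a\<^sub>0, \<dots>, a\<^sub>m]\<close> is \<open>[a\<^sub>0, \<dots>, a\<^sub>i a\<^bsub>i+1\<^esub>, \<dots>, a\<^sub>m]\<close>, and the product of symbols is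
  \<open>(a\<^sub>0, \<dots>, a\<^sub>n)(a\<^bsub>n+1\<^esub>, \<dots>, a\<^sub>m) =
    \<Sum>\<^bsub>0 \<le> i \<le> n\<^esub> (-1)\<^bsup>n-i\<^esup> (a\<^sub>0, \<dots>, a\<^sub>i a\<^bsub>i+1\<^esub>, \<dots>, a\<^sub>m)\<close>.
\<close>

definition contract :: "(complex, 'a, 'b) module_scheme \<Rightarrow> nat \<Rightarrow> 'a list \<Rightarrow> 'a list"
  where "contract A i as = take i as @ (as ! i \<otimes>\<^bsub>A\<^esub> as ! Suc i) # drop (Suc (Suc i)) as"

definition symbol_mult :: "(complex, 'a, 'b) module_scheme \<Rightarrow> 'a list \<Rightarrow> 'a list \<Rightarrow> ('a list \<Rightarrow>\<^sub>0 complex)"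
  where "symbol_mult A as bs =
    (let n = length as - 1 in \<Sum>i=0..n. scale ((-1) ^ (n - i)) (basis (contract A i (as @ bs))))"

definition symbol_d :: "(complex, 'a, 'b) module_scheme \<Rightarrow> 'a list \<Rightarrow> ('a list \<Rightarrow>\<^sub>0 complex)"
  where "symbol_d A as = basis (\<one>\<^bsub>A\<^esub> # as)"

definition form_mult ::
    "(complex, 'a, 'b) module_scheme \<Rightarrow> 'a set \<Rightarrow> nat \<Rightarrow> nat \<Rightarrow>
      ('a list \<Rightarrow>\<^sub>0 complex) set \<Rightarrow> ('a list \<Rightarrow>\<^sub>0 complex) set \<Rightarrow> ('a list \<Rightarrow>\<^sub>0 complex) set"
  where "form_mult A V i j \<alpha> \<beta> =
    (\<Union>x\<in>\<alpha>. \<Union>y\<in>\<beta>. form_relations A V (i + j)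
        +>\<^bsub>free_forms A (i + j)\<^esub> bilin_ext (symbol_mult A) x y)"

definition form_d ::
    "(complex, 'a, 'b) module_scheme \<Rightarrow> 'a set \<Rightarrow> nat \<Rightarrow> ('a list \<Rightarrow>\<^sub>0 complex) set \<Rightarrow> ('a list \<Rightarrow>\<^sub>0 complex) set"
  where "form_d A V n =
    induced_map (free_forms A (Suc n)) (form_relations A V (Suc n)) (lin_ext (symbol_d A))"

section \<open>The relative Karoubi complex\<close>

definition supercommutator ::
    "(complex, 'a, 'b) module_scheme \<Rightarrow> 'a set \<Rightarrow> nat \<Rightarrow> nat \<Rightarrow>
      ('a list \<Rightarrow>\<^sub>0 complex) set \<Rightarrow> ('a list \<Rightarrow>\<^sub>0 complex) set \<Rightarrow> ('a list \<Rightarrow>\<^sub>0 complex) set"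
  where "supercommutator A V i j \<alpha> \<beta> =
    form_mult A V i j \<alpha> \<beta>
      \<ominus>\<^bsub>forms A V (i + j)\<^esub> ((-1) ^ (i * j) \<odot>\<^bsub>forms A V (i + j)\<^esub> form_mult A V j i \<beta> \<alpha>)"

definition supercommutators ::
    "(complex, 'a, 'b) module_scheme \<Rightarrow> 'a set \<Rightarrow> nat \<Rightarrow> ('a list \<Rightarrow>\<^sub>0 complex) set set"
  where "supercommutators A V n = module_span complex_field (forms A V n)
    (\<Union>i\<in>{0..n}. {supercommutator A V i (n - i) \<alpha> \<beta> | \<alpha> \<beta>.
        \<alpha> \<in> carrier (forms A V i) \<and> \<beta> \<in> carrier (forms A V (n - i))})"

definition dR ::
    "(complex, 'a, 'b) module_scheme \<Rightarrow> 'a set \<Rightarrow> nat \<Rightarrow> (complex, ('a list \<Rightarrow>\<^sub>0 complex) set set) module"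
  where "dR A V n = quot_module (forms A V n) (supercommutators A V n)"

definition dR_d ::
    "(complex, 'a, 'b) module_scheme \<Rightarrow> 'a set \<Rightarrow> nat \<Rightarrow>
      ('a list \<Rightarrow>\<^sub>0 complex) set set \<Rightarrow> ('a list \<Rightarrow>\<^sub>0 complex) set set"
  where "dR_d A V n = induced_map (forms A V (Suc n)) (supercommutators A V (Suc n)) (form_d A V n)"

definition dR_cohomology ::
    "(complex, 'a, 'b) module_scheme \<Rightarrow> 'a set \<Rightarrow> nat \<Rightarrow> (complex, ('a list \<Rightarrow>\<^sub>0 complex) set set set) module"
  where "dR_cohomology A V n = cohomology (dR A V) (dR_d A V) n"

text \<open>The canonical map from \<open>V\<close> to the cohomology in degree 0, induced by the inclusion of \<open>V\<close> in \<open>A\<close>.\<close>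

definition dR_unit :: "(complex, 'a, 'b) module_scheme \<Rightarrow> 'a set \<Rightarrow> 'a \<Rightarrow> ('a list \<Rightarrow>\<^sub>0 complex) set set set"
  where "dR_unit A V v =
    coboundaries (dR A V) (dR_d A V) 0 +>\<^bsub>dR A V 0\<^esub>
      (supercommutators A V 0 +>\<^bsub>forms A V 0\<^esub>
        (form_relations A V 0 +>\<^bsub>free_forms A 0\<^esub> basis [v]))"

definition dR_acyclic :: "(complex, 'a, 'b) module_scheme \<Rightarrow> 'a set \<Rightarrow> bool"
  where "dR_acyclic A V \<longleftrightarrow>
    cochain_complex complex_field (dR A V) (dR_d A V) \<and>
    dR_unit A V \<in> linear_isos complex_field (A\<lparr>carrier := V\<rparr>) (dR_cohomology A V 0) \<and>
    (\<forall>n\<ge>1. carrier (dR_cohomology A V n) = {\<zero>\<^bsub>dR_cohomology A V n\<^esub>})"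

end

theory Submission
  imports Defs
begin

text \<open>
  Let \<open>\<theta>\<close> be the Euler derivation of the path algebra, \<open>\<theta> p = |p| p\<close> for a path \<open>p\<close> of length \<open>|p|\<close>; it vanishes
  on \<open>V\<close>.  Contraction with \<open>\<theta>\<close> is the superderivation \<open>\<iota>\<close> of degree \<open>-1\<close> of the forms with \<open>\<iota>(a) = 0\<close> and
  \<open>\<iota>(da) = \<theta> a\<close>.  Like \<open>d\<close> it preserves supercommutators, so it acts on the Karoubi complex, and
  \<open>d\<iota> + \<iota>d\<close> multiplies the form \<open>p\<^sub>0 dp\<^sub>1 \<cdots> dp\<^sub>n\<close> of paths by its weight \<open>|p\<^sub>0| + \<cdots> + |p\<^sub>n|\<close>.  Hence the part
  of positive weight is acyclic.  The part of weight zero vanishes in positive degrees because \<open>dv = 0\<close>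
  for \<open>v \<in> V\<close>, and in degree zero it is \<open>V\<close>, which meets \<open>[A, A]\<close> trivially because the coefficients of
  the vertex idempotents are traces.

  All computations take place in the free vector space on symbols, modulo the relations.  The
  product of forms is controlled by \<open>a\<^sub>0 da\<^sub>1 \<cdots> da\<^sub>n \<cdot> \<beta> = L(a\<^sub>0) [d, L(a\<^sub>1)] \<cdots> [d, L(a\<^sub>n)] \<beta>\<close>, where \<open>L(a)\<close> is
  left multiplication by \<open>a\<close>.
\<close>

section \<open>Linear maps between free vector spaces\<close>

text \<open>On cosets the product of forms is a union, over all representatives, of an alternating
  sum, so its independence of representatives has to be proved before it can be used. On the
  alternating sum itself this would mix neighbouring contractions. The commutators [d, L(a)]
  separate the entries: modulo relations they are additive and homogeneous in a and vanish for a in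
  V, and they satisfy a Leibniz rule. These properties answer the relators of the tensor product
  over V one by one. They also give the superderivation rules of d and \<iota>, with associativity
  entering only for left factors a and da.

  Stability under the Lie derivative replaces gradedness. In degree 0 the trace argument rests on
  the fact that a product of two paths has length zero only if both do, so that loops and oriented
  cycles do not disturb the coefficient of a vertex idempotent.\<close>

lemma lookup_scale [simp]: "Poly_Mapping.lookup (scale c f) x = c * Poly_Mapping.lookup f x"
  unfolding scale_def by transfer (simp add: when_def)

text \<open>Provides spans and subspaces on the type of finitely supported functions. The arguments
  run in this setting and are carried over to the module records only at the end.\<close>

interpretation pm: vector_space scale
  by unfold_locales (auto intro!: poly_mapping_eqI simp: lookup_add algebra_simps)

abbreviation lin :: "(('x \<Rightarrow>\<^sub>0 complex) \<Rightarrow> ('y \<Rightarrow>\<^sub>0 complex)) \<Rightarrow> bool"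
  where "lin \<equiv> module_hom scale scale"

lemma linI:
  assumes "\<And>x y. f (x + y) = f x + f y" and "\<And>c x. f (scale c x) = scale c (f x)"
  shows "lin f"
  using assms by unfold_locales auto

lemmas lin_add = module_hom.add
  and lin_scale = module_hom.scale
  and lin_diff = module_hom.diff
  and lin_zero = module_hom.zero

lemma scale_single [simp]: "scale c (Poly_Mapping.single x d) = Poly_Mapping.single x (c * d)"
  by (intro poly_mapping_eqI) (simp add: lookup_single when_def)

text \<open>Summands with different supports can be compared once all sums run over one common
  finite set.\<close>

lemma lin_ext_superset:
  assumes "finite S" and "Poly_Mapping.keys f \<subseteq> S"
  shows "lin_ext \<phi> f = (\<Sum>x\<in>S. scale (Poly_Mapping.lookup f x) (\<phi> x))"
  unfolding lin_ext_def
  by (rule sum.mono_neutral_left) (use assms in \<open>auto simp: in_keys_iff\<close>)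

lemma lin_lin_ext: "lin (lin_ext \<phi>)"
proof (rule linI)
  fix x y :: "'a \<Rightarrow>\<^sub>0 complex"
  let ?S = "Poly_Mapping.keys x \<union> Poly_Mapping.keys y"
  show "lin_ext \<phi> (x + y) = lin_ext \<phi> x + lin_ext \<phi> y"
    using keys_add[of x y]
    by (simp add: lin_ext_superset[of ?S] lookup_add pm.scale_left_distrib sum.distrib)
next
  fix c and x :: "'a \<Rightarrow>\<^sub>0 complex"
  have "Poly_Mapping.keys (scale c x) \<subseteq> Poly_Mapping.keys x"
    by (auto simp: in_keys_iff)
  then show "lin_ext \<phi> (scale c x) = scale c (lin_ext \<phi> x)"
    by (simp add: lin_ext_superset[of "Poly_Mapping.keys x"] pm.scale_sum_right)
qed

lemmas lin_ext_zero [simp] = lin_zero[OF lin_lin_ext]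

lemma lin_ext_basis [simp]: "lin_ext \<phi> (basis x) = \<phi> x"
  by (simp add: lin_ext_def)

lemma bilin_ext_basis [simp]: "bilin_ext \<phi> (basis x) (basis y) = \<phi> x y"
  by (simp add: bilin_ext_def)

lemma lin_comp: "lin f \<Longrightarrow> lin g \<Longrightarrow> lin (\<lambda>x. f (g x))"
  using module_hom_compose[of scale scale g scale f] by (simp add: o_def)

lemma lin_minus: "lin f \<Longrightarrow> lin g \<Longrightarrow> lin (\<lambda>x. f x - g x)"
  by (rule linI) (simp_all add: lin_add lin_scale pm.scale_right_diff_distrib)

lemma lin_plus: "lin f \<Longrightarrow> lin g \<Longrightarrow> lin (\<lambda>x. f x + g x)"
  by (rule linI) (simp_all add: lin_add lin_scale pm.scale_right_distrib)

lemma lin_scaled: "lin f \<Longrightarrow> lin (\<lambda>x. scale c (f x))"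
  by (rule linI) (simp_all add: lin_add lin_scale pm.scale_right_distrib mult.commute)

lemma lin_ident: "lin (\<lambda>x. x)"
  by (rule linI) simp_all

lemma lin_bilin_ext_left: "lin (\<lambda>x. bilin_ext \<phi> x y)"
  unfolding bilin_ext_def by (rule lin_lin_ext)

lemma lin_ext_fun:
  assumes "\<And>x. x \<in> S \<Longrightarrow> lin (\<psi> x)" and "Poly_Mapping.keys f \<subseteq> S"
  shows "lin (\<lambda>y. lin_ext (\<lambda>x. \<psi> x y) f)"
proof -
  have \<psi>: "lin (\<psi> x)" if "x \<in> Poly_Mapping.keys f" for x
    using assms that by auto
  show ?thesis
    unfolding lin_ext_def
    by (rule linI)
      (simp_all add: lin_add[OF \<psi>] lin_scale[OF \<psi>] pm.scale_right_distrib sum.distrib pm.scale_sum_right mult.commute)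
qed

lemma lin_bilin_ext_right: "lin (bilin_ext \<phi> x)"
  unfolding bilin_ext_def by (rule lin_ext_fun[of UNIV]) (auto intro: lin_lin_ext)

text \<open>Replaces a condition on supports by a span, so that claims about all elements reduce to
  basis vectors.\<close>

lemma free_eq_span: "{f. Poly_Mapping.keys f \<subseteq> S} = pm.span (basis ` S)"
proof (intro equalityI subsetI)
  fix f :: "'a \<Rightarrow>\<^sub>0 complex"
  assume "f \<in> {f. Poly_Mapping.keys f \<subseteq> S}"
  then have *: "Poly_Mapping.keys f \<subseteq> S" by simp
  have "f = (\<Sum>x\<in>Poly_Mapping.keys f. scale (Poly_Mapping.lookup f x) (basis x))"
    by (intro poly_mapping_eqI) (auto simp: lookup_sum lookup_single when_def in_keys_iff)
  also have "\<dots> \<in> pm.span (basis ` S)"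
    using * by (intro pm.span_sum pm.span_scale pm.span_base) auto
  finally show "f \<in> pm.span (basis ` S)" .
next
  fix f :: "'a \<Rightarrow>\<^sub>0 complex"
  have sub: "pm.subspace {f. Poly_Mapping.keys f \<subseteq> S}"
  proof (rule pm.subspaceI)
    fix x y :: "'a \<Rightarrow>\<^sub>0 complex" and c
    show "0 \<in> {f. Poly_Mapping.keys f \<subseteq> S}" by simp
    show "x \<in> {f. Poly_Mapping.keys f \<subseteq> S} \<Longrightarrow> y \<in> {f. Poly_Mapping.keys f \<subseteq> S} \<Longrightarrow> x + y \<in> {f. Poly_Mapping.keys f \<subseteq> S}"
      using keys_add[of x y] by auto
    show "x \<in> {f. Poly_Mapping.keys f \<subseteq> S} \<Longrightarrow> scale c x \<in> {f. Poly_Mapping.keys f \<subseteq> S}"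
      by (auto simp: in_keys_iff)
  qed
  have "basis ` S \<subseteq> {f. Poly_Mapping.keys f \<subseteq> S}" by auto
  then show "f \<in> pm.span (basis ` S) \<Longrightarrow> f \<in> {f. Poly_Mapping.keys f \<subseteq> S}"
    using pm.span_minimal[OF _ sub] by blast
qed

lemma subspace_lin_vimage: "lin f \<Longrightarrow> pm.subspace T \<Longrightarrow> pm.subspace {x. f x \<in> T}"
  by (rule module_hom.subspace_linear_preimage)

text \<open>The reduction to generators behind most proofs below. With \<open>T = {0}\<close> and a
  difference of maps for \<open>f\<close> it proves equalities; with \<open>T\<close> the relations
  it proves congruences.\<close>

lemma lin_span_into:
  assumes "lin f" and "pm.subspace T" and "\<And>s. s \<in> S \<Longrightarrow> f s \<in> T" and "x \<in> pm.span S"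
  shows "f x \<in> T"
  using pm.span_minimal[OF _ subspace_lin_vimage[OF assms(1,2)], of S] assms(3,4) by auto

section \<open>Quotient modules\<close>

lemma submodule_abelian_subgroup:
  assumes "module R M" and "submodule N R M"
  shows "abelian_subgroup N M"
  using assms
  by (intro abelian_subgroupI3 additive_subgroupI) (auto simp: module_def submodule_def)

lemma a_coset_eq_iff:
  assumes M: "module R M" and N: "submodule N R M" and x: "x \<in> carrier M" and y: "y \<in> carrier M"
  shows "N +>\<^bsub>M\<^esub> x = N +>\<^bsub>M\<^esub> y \<longleftrightarrow> x \<ominus>\<^bsub>M\<^esub> y \<in> N"
proof -
  interpret N: abelian_subgroup N M
    by (rule submodule_abelian_subgroup[OF M N])
  show ?thesis
    using N.a_rcos_module[of y x] N.a_repr_independence'[of x y] N.a_repr_independenceD[of y x] x y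
      N.a_rcos_self[OF x]
    by (auto simp: a_minus_def)
qed


lemma quot_module_carrier: "carrier (quot_module M N) = (\<lambda>x. N +>\<^bsub>M\<^esub> x) ` carrier M"
  by (auto simp: quot_module_def A_RCOSETS_def')

lemma quot_module_add:
  assumes "module R M" and "submodule N R M" and "x \<in> carrier M" and "y \<in> carrier M"
  shows "(N +>\<^bsub>M\<^esub> x) \<oplus>\<^bsub>quot_module M N\<^esub> (N +>\<^bsub>M\<^esub> y) = N +>\<^bsub>M\<^esub> (x \<oplus>\<^bsub>M\<^esub> y)"
  using abelian_subgroup.a_rcos_sum[OF submodule_abelian_subgroup[OF assms(1,2)] assms(3,4)]
  by (simp add: quot_module_def)

lemma quot_module_zero:
  assumes "module R M" and "submodule N R M"
  shows "\<zero>\<^bsub>quot_module M N\<^esub> = N +>\<^bsub>M\<^esub> \<zero>\<^bsub>M\<^esub>"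
proof -
  interpret N: abelian_subgroup N M
    by (rule submodule_abelian_subgroup[OF assms])
  show ?thesis
    using N.a_coset_add_zero[OF N.a_subset] by (simp add: quot_module_def)
qed

text \<open>The induced map is a union over all representatives. By \<open>cong\<close> every
  representative contributes the same coset, so the union collapses to that coset.\<close>

lemma induced_map_coset:
  assumes M: "module R M" "submodule N R M" and M': "module R M'" "submodule N' R M'"
    and f: "\<And>x. x \<in> carrier M \<Longrightarrow> f x \<in> carrier M'"
    and cong: "\<And>x y. x \<in> carrier M \<Longrightarrow> y \<in> carrier M \<Longrightarrow> x \<ominus>\<^bsub>M\<^esub> y \<in> N \<Longrightarrow> f x \<ominus>\<^bsub>M'\<^esub> f y \<in> N'"
    and x: "x \<in> carrier M"
  shows "induced_map M' N' f (N +>\<^bsub>M\<^esub> x) = N' +>\<^bsub>M'\<^esub> f x"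
proof -
  interpret N: abelian_subgroup N M
    by (rule submodule_abelian_subgroup[OF M])
  have "N' +>\<^bsub>M'\<^esub> f y = N' +>\<^bsub>M'\<^esub> f x" if "y \<in> N +>\<^bsub>M\<^esub> x" for y
  proof -
    have y: "y \<in> carrier M"
      using N.a_elemrcos_carrier[OF x that] .
    have "y \<ominus>\<^bsub>M\<^esub> x \<in> N"
      using N.a_rcos_module[OF x y] that by (simp add: a_minus_def)
    then show ?thesis
      using cong[OF y x] f[OF x] f[OF y] by (simp add: a_coset_eq_iff[OF M'])
  qed
  moreover have "x \<in> N +>\<^bsub>M\<^esub> x"
    using N.a_rcos_self[OF x] .
  ultimately show ?thesis
    unfolding induced_map_def by blast
qed

lemma smult_minus_distrib:
  assumes "module R M" and "c \<in> carrier R" and "x \<in> carrier M" and "y \<in> carrier M"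
  shows "c \<odot>\<^bsub>M\<^esub> x \<ominus>\<^bsub>M\<^esub> c \<odot>\<^bsub>M\<^esub> y = c \<odot>\<^bsub>M\<^esub> (x \<ominus>\<^bsub>M\<^esub> y)"
proof -
  interpret module R M by (rule assms)
  show ?thesis
    using assms by (simp add: a_minus_def smult_r_distr smult_r_minus)
qed

lemma quot_module_smult:
  assumes M: "module R M" "submodule N R M" and c: "c \<in> carrier R" and x: "x \<in> carrier M"
  shows "c \<odot>\<^bsub>quot_module M N\<^esub> (N +>\<^bsub>M\<^esub> x) = N +>\<^bsub>M\<^esub> (c \<odot>\<^bsub>M\<^esub> x)"
proof -
  have "c \<odot>\<^bsub>quot_module M N\<^esub> (N +>\<^bsub>M\<^esub> x) = induced_map M N (\<lambda>x. c \<odot>\<^bsub>M\<^esub> x) (N +>\<^bsub>M\<^esub> x)"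
    by (simp add: quot_module_def induced_map_def)
  also have "\<dots> = N +>\<^bsub>M\<^esub> (c \<odot>\<^bsub>M\<^esub> x)"
    by (rule induced_map_coset[OF M M])
      (use M c x in \<open>auto simp: module.smult_closed smult_minus_distrib submodule.smult_closed\<close>)
  finally show ?thesis .
qed

lemma module_quot_module:
  assumes M: "module R M" and N: "submodule N R M"
  shows "module R (quot_module M N)"
proof -
  interpret M: module R M by (rule M)
  note reps = quot_module_carrier quot_module_add[OF M N] quot_module_zero[OF M N]
    quot_module_smult[OF M N]
  show ?thesis
  proof (rule moduleI)
    show "cring R" by (rule M.R.is_cring)
    show "abelian_group (quot_module M N)"
    proof (rule abelian_groupI)
      fix U assume "U \<in> carrier (quot_module M N)"
      then obtain x where x: "U = N +>\<^bsub>M\<^esub> x" "x \<in> carrier M"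
        by (auto simp: reps)
      then show "\<exists>Y\<in>carrier (quot_module M N). Y \<oplus>\<^bsub>quot_module M N\<^esub> U = \<zero>\<^bsub>quot_module M N\<^esub>"
        by (intro bexI[of _ "N +>\<^bsub>M\<^esub> (\<ominus>\<^bsub>M\<^esub> x)"]) (auto simp: reps M.M.l_neg)
    qed (auto simp: reps M.M.a_ac)
  qed (auto simp: reps M.smult_l_distr M.smult_r_distr M.smult_assoc1)
qed

lemma quot_module_minus:
  assumes M: "module R M" and N: "submodule N R M" and x: "x \<in> carrier M" and y: "y \<in> carrier M"
  shows "(N +>\<^bsub>M\<^esub> x) \<ominus>\<^bsub>quot_module M N\<^esub> (N +>\<^bsub>M\<^esub> y) = N +>\<^bsub>M\<^esub> (x \<ominus>\<^bsub>M\<^esub> y)"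
proof -
  interpret M: module R M by (rule M)
  interpret Q: module R "quot_module M N" by (rule module_quot_module[OF M N])
  have "\<ominus>\<^bsub>quot_module M N\<^esub> (N +>\<^bsub>M\<^esub> y) = N +>\<^bsub>M\<^esub> (\<ominus>\<^bsub>M\<^esub> y)"
    by (rule Q.M.minus_equality)
      (use y in \<open>auto simp: quot_module_carrier quot_module_add[OF M N] quot_module_zero[OF M N] M.M.l_neg\<close>)
  then show ?thesis
    using x y by (simp add: a_minus_def quot_module_add[OF M N])
qed

text \<open>The canonical map runs from \<open>V\<close> to the cohomology, whereas the final
  isomorphism runs the other way. Closure under the operations stands in for a module structure on
  the source, which suits \<open>V\<close> with the operations of \<open>A\<close>.\<close>

lemma linear_isos_inv:
  assumes f: "f \<in> linear_isos R M N"
    and add: "\<And>x y. x \<in> carrier M \<Longrightarrow> y \<in> carrier M \<Longrightarrow> x \<oplus>\<^bsub>M\<^esub> y \<in> carrier M"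
    and smult: "\<And>c x. c \<in> carrier R \<Longrightarrow> x \<in> carrier M \<Longrightarrow> c \<odot>\<^bsub>M\<^esub> x \<in> carrier M"
  shows "the_inv_into (carrier M) f \<in> linear_isos R N M"
proof -
  let ?g = "the_inv_into (carrier M) f"
  have bij: "bij_betw f (carrier M) (carrier N)" and lin: "f \<in> linear_maps R M N"
    using f by (auto simp: linear_isos_def)
  have g: "?g u \<in> carrier M" "f (?g u) = u" if "u \<in> carrier N" for u
    using that bij by (auto simp: bij_betw_def the_inv_into_into f_the_inv_into_f)
  have gf: "?g (f x) = x" if "x \<in> carrier M" for x
    using that bij by (auto simp: bij_betw_def the_inv_into_f_f)
  have "?g (u \<oplus>\<^bsub>N\<^esub> w) = ?g u \<oplus>\<^bsub>M\<^esub> ?g w" if "u \<in> carrier N" "w \<in> carrier N" for u w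
  proof -
    have "u \<oplus>\<^bsub>N\<^esub> w = f (?g u \<oplus>\<^bsub>M\<^esub> ?g w)"
      using lin g that by (auto simp: linear_maps_def)
    then show ?thesis
      using gf add g that by auto
  qed
  moreover have "?g (c \<odot>\<^bsub>N\<^esub> u) = c \<odot>\<^bsub>M\<^esub> ?g u" if "c \<in> carrier R" "u \<in> carrier N" for c u
  proof -
    have "c \<odot>\<^bsub>N\<^esub> u = f (c \<odot>\<^bsub>M\<^esub> ?g u)"
      using lin g that by (auto simp: linear_maps_def)
    then show ?thesis
      using gf smult g that by auto
  qed
  ultimately show ?thesis
    using g bij_betw_the_inv_into[OF bij] by (auto simp: linear_isos_def linear_maps_def)
qed

section \<open>Relative forms as operators\<close>

lemma carrier_complex_field [simp]: "carrier complex_field = (UNIV :: complex set)"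
  by (simp add: ring_of_type_algebra_def)

section \<open>Symbols and their congruence modulo the tensor relations\<close>

locale relative_algebra =
  fixes A :: "(complex, 'a, 'b) module_scheme" (structure) and V :: "'a set"
  assumes ring_A: "ring A"
    and module_A: "module complex_field A"
    and smult_mult_left: "a \<in> carrier A \<Longrightarrow> b \<in> carrier A \<Longrightarrow> (c \<odot> a) \<otimes> b = c \<odot> (a \<otimes> b)"
    and smult_mult_right: "a \<in> carrier A \<Longrightarrow> b \<in> carrier A \<Longrightarrow> a \<otimes> (c \<odot> b) = c \<odot> (a \<otimes> b)"
    and V_subset: "V \<subseteq> carrier A"
    and one_in_V: "\<one> \<in> V"
begin

sublocale ring A by (rule ring_A)

lemma smult_carrier [simp]: "a \<in> carrier A \<Longrightarrow> c \<odot> a \<in> carrier A"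
  using module.smult_closed[OF module_A] by simp

lemma V_carrier [simp]: "v \<in> V \<Longrightarrow> v \<in> carrier A"
  using V_subset by auto

lemma zero_smult: "a \<in> carrier A \<Longrightarrow> 0 \<odot> a = \<zero>"
  using module.smult_l_null[OF module_A, of a] by (simp add: ring_of_type_algebra_def)

text \<open>Symbols of all degrees at once; they are non-empty because the head is the coefficient
  in front of the differentials.\<close>

definition Symbols :: "'a list set"
  where "Symbols = {as. as \<noteq> [] \<and> set as \<subseteq> carrier A}"

definition Free :: "('a list \<Rightarrow>\<^sub>0 complex) set"
  where "Free = pm.span (basis ` Symbols)"

definition Free_deg :: "nat \<Rightarrow> ('a list \<Rightarrow>\<^sub>0 complex) set"
  where "Free_deg n = pm.span (basis ` symbols A n)"

text \<open>Relators of all degrees are collected in one subspace, so that congruences need no degree.\<close>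

definition Rel :: "('a list \<Rightarrow>\<^sub>0 complex) set"
  where "Rel = pm.span (\<Union>n. form_relators A V n)"

definition eqv :: "('a list \<Rightarrow>\<^sub>0 complex) \<Rightarrow> ('a list \<Rightarrow>\<^sub>0 complex) \<Rightarrow> bool"  (infix \<open>\<approx>\<close> 50)
  where "x \<approx> y \<longleftrightarrow> x - y \<in> Rel"

lemma subspace_Free [simp]: "pm.subspace Free" and subspace_Free_deg [simp]: "pm.subspace (Free_deg n)"
  and subspace_Rel [simp]: "pm.subspace Rel"
  by (simp_all add: Free_def Free_deg_def Rel_def)

lemmas Rel_closed [simp] = pm.subspace_0[OF subspace_Rel] pm.subspace_add[OF subspace_Rel]
    pm.subspace_diff[OF subspace_Rel] pm.subspace_neg[OF subspace_Rel] pm.subspace_scale[OF subspace_Rel]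
  and Free_closed [simp] = pm.subspace_0[OF subspace_Free] pm.subspace_add[OF subspace_Free]
    pm.subspace_diff[OF subspace_Free] pm.subspace_neg[OF subspace_Free] pm.subspace_scale[OF subspace_Free]
  and Free_deg_closed [simp] = pm.subspace_0[OF subspace_Free_deg] pm.subspace_add[OF subspace_Free_deg]
    pm.subspace_diff[OF subspace_Free_deg] pm.subspace_neg[OF subspace_Free_deg] pm.subspace_scale[OF subspace_Free_deg]

lemma Symbols_Cons [simp]: "a # as \<in> Symbols \<longleftrightarrow> a \<in> carrier A \<and> set as \<subseteq> carrier A"
  by (auto simp: Symbols_def)

lemma Symbols_append_Cons [simp]:
  "xs @ a # ys \<in> Symbols \<longleftrightarrow> set xs \<subseteq> carrier A \<and> a \<in> carrier A \<and> set ys \<subseteq> carrier A"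
  by (auto simp: Symbols_def)

lemma basis_Free [simp]: "as \<in> Symbols \<Longrightarrow> basis as \<in> Free"
  by (simp add: Free_def pm.span_base)

lemma basis_Free_deg [simp]: "as \<in> symbols A n \<Longrightarrow> basis as \<in> Free_deg n"
  by (simp add: Free_deg_def pm.span_base)

lemma symbols_Symbols: "as \<in> symbols A n \<Longrightarrow> as \<in> Symbols"
  by (auto simp: Symbols_def symbols_def)

lemma Free_deg_Free: "x \<in> Free_deg n \<Longrightarrow> x \<in> Free"
  using subsetD[OF pm.span_mono[of "basis ` symbols A n" "basis ` Symbols"]] symbols_Symbols
  by (auto simp: Free_def Free_deg_def)

lemma lin_Free_into:
  assumes "lin f" and "pm.subspace T" and "\<And>b bs. b # bs \<in> Symbols \<Longrightarrow> f (basis (b # bs)) \<in> T" and "x \<in> Free"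
  shows "f x \<in> T"
proof (rule lin_span_into[OF assms(1,2)])
  fix s assume "s \<in> basis ` Symbols"
  then obtain as where "s = basis as" "as \<in> Symbols" by auto
  then show "f s \<in> T"
    using assms(3) by (cases as) (simp_all add: Symbols_def)
qed (use assms(4) in \<open>simp add: Free_def\<close>)

lemma lin_Free_deg_into:
  assumes "lin f" and "pm.subspace T" and "\<And>as. as \<in> symbols A n \<Longrightarrow> f (basis as) \<in> T" and "x \<in> Free_deg n"
  shows "f x \<in> T"
  by (rule lin_span_into[OF assms(1,2)]) (use assms(3,4) in \<open>auto simp: Free_deg_def\<close>)

lemma lin_Free_eq:
  assumes "lin f" and "lin g" and "\<And>b bs. b # bs \<in> Symbols \<Longrightarrow> f (basis (b # bs)) = g (basis (b # bs))" and "x \<in> Free"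
  shows "f x = g x"
  using lin_Free_into[OF lin_minus[OF assms(1,2)] pm.subspace_single_0 _ assms(4)] assms(3) by auto

lemma lin_Free_eqv:
  assumes "lin f" and "lin g" and "\<And>b bs. b # bs \<in> Symbols \<Longrightarrow> f (basis (b # bs)) \<approx> g (basis (b # bs))" and "x \<in> Free"
  shows "f x \<approx> g x"
  using lin_Free_into[OF lin_minus[OF assms(1,2)] subspace_Rel _ assms(4)] assms(3) by (auto simp: eqv_def)

lemma eqv_refl [simp]: "x \<approx> x"
  by (simp add: eqv_def)

lemma eqv_sym: "x \<approx> y \<Longrightarrow> y \<approx> x"
  using pm.subspace_neg[OF subspace_Rel, of "x - y"] by (simp add: eqv_def)

lemma eqv_trans [trans]: "x \<approx> y \<Longrightarrow> y \<approx> z \<Longrightarrow> x \<approx> z"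
  using pm.subspace_add[OF subspace_Rel, of "x - y" "y - z"] by (simp add: eqv_def)

lemma eqv_add: "x \<approx> y \<Longrightarrow> x' \<approx> y' \<Longrightarrow> x + x' \<approx> y + y'"
  using pm.subspace_add[OF subspace_Rel, of "x - y" "x' - y'"] by (simp add: eqv_def algebra_simps)

lemma eqv_diff: "x \<approx> y \<Longrightarrow> x' \<approx> y' \<Longrightarrow> x - x' \<approx> y - y'"
  using pm.subspace_diff[OF subspace_Rel, of "x - y" "x' - y'"] by (simp add: eqv_def algebra_simps)

lemma eqv_scale: "x \<approx> y \<Longrightarrow> scale c x \<approx> scale c y"
  using pm.subspace_scale[OF subspace_Rel, of "x - y" c] by (simp add: eqv_def pm.scale_right_diff_distrib)

lemma eqv_lin: "lin f \<Longrightarrow> (\<And>z. z \<in> Rel \<Longrightarrow> f z \<in> Rel) \<Longrightarrow> x \<approx> y \<Longrightarrow> f x \<approx> f y"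
  by (metis eqv_def lin_diff)

lemma Rel_base: "r \<in> form_relators A V n \<Longrightarrow> r \<in> Rel"
  by (auto simp: Rel_def intro: pm.span_base)

lemma symbols_append_Cons:
  "xs @ a # ys \<in> symbols A (length xs + length ys) \<longleftrightarrow>
    set xs \<subseteq> carrier A \<and> a \<in> carrier A \<and> set ys \<subseteq> carrier A"
  by (auto simp: symbols_def)

lemma relator_add:
  assumes "set xs \<subseteq> carrier A" "set ys \<subseteq> carrier A" "a \<in> carrier A" "b \<in> carrier A"
  shows "basis (xs @ (a \<oplus> b) # ys) \<approx> basis (xs @ a # ys) + basis (xs @ b # ys)"
proof -
  have "basis (xs @ (a \<oplus> b) # ys) - basis (xs @ a # ys) - basis (xs @ b # ys)
    \<in> form_relators A V (length xs + length ys)"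
    unfolding form_relators_def
    by (rule UnI1, rule UnI1, rule UnI1, rule CollectI, (rule exI)+, rule conjI[OF refl])
      (use assms symbols_append_Cons in auto)
  then show ?thesis
    unfolding eqv_def diff_diff_eq[symmetric] by (rule Rel_base)
qed

lemma relator_smult:
  assumes "set xs \<subseteq> carrier A" "set ys \<subseteq> carrier A" "a \<in> carrier A"
  shows "basis (xs @ (c \<odot> a) # ys) \<approx> scale c (basis (xs @ a # ys))"
proof -
  have "basis (xs @ (c \<odot> a) # ys) - scale c (basis (xs @ a # ys))
    \<in> form_relators A V (length xs + length ys)"
    unfolding form_relators_def
    by (rule UnI1, rule UnI1, rule UnI2, rule CollectI, (rule exI)+, rule conjI[OF refl])
      (use assms symbols_append_Cons in auto)
  then show ?thesis
    unfolding eqv_def by (rule Rel_base)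
qed

lemma relator_balanced:
  assumes "set xs \<subseteq> carrier A" "set ys \<subseteq> carrier A" "a \<in> carrier A" "b \<in> carrier A" "v \<in> V"
  shows "basis (xs @ (a \<otimes> v) # b # ys) \<approx> basis (xs @ a # (v \<otimes> b) # ys)"
proof -
  have "basis (xs @ (a \<otimes> v) # b # ys) - basis (xs @ a # (v \<otimes> b) # ys)
    \<in> form_relators A V (length xs + length (b # ys))"
    unfolding form_relators_def
    by (rule UnI1, rule UnI2, rule CollectI, (rule exI)+, rule conjI[OF refl])
      (use assms symbols_append_Cons[of xs a "b # ys"] in auto)
  then show ?thesis
    unfolding eqv_def by (rule Rel_base)
qed

lemma relator_V:
  assumes "set xs \<subseteq> carrier A" "set ys \<subseteq> carrier A" "xs \<noteq> []" "v \<in> V"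
  shows "basis (xs @ v # ys) \<in> Rel"
proof -
  have "basis (xs @ v # ys) \<in> form_relators A V (length xs + length ys)"
    unfolding form_relators_def
    by (rule UnI2, rule CollectI, (rule exI)+, rule conjI[OF refl])
      (use assms symbols_append_Cons[of xs v ys] in auto)
  then show ?thesis
    by (rule Rel_base)
qed

text \<open>Homogeneity with the scalar 0; this covers the first entry too, where elements of
  \<open>V\<close> need not vanish.\<close>

lemma relator_zero:
  assumes "set xs \<subseteq> carrier A" "set ys \<subseteq> carrier A"
  shows "basis (xs @ \<zero> # ys) \<in> Rel"
  using relator_smult[OF assms zero_closed, of 0] by (simp add: zero_smult eqv_def)

text \<open>One obligation for each of the four families of relators. In the last one the list
  starts with \<open>x #\<close> because elements of \<open>V\<close> vanish only after the first
  entry.\<close>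

lemma lin_Rel_into:
  assumes f: "lin f" and T: "pm.subspace T" and x: "x \<in> Rel"
    and add: "\<And>xs a b ys. set xs \<subseteq> carrier A \<Longrightarrow> set ys \<subseteq> carrier A \<Longrightarrow> a \<in> carrier A \<Longrightarrow> b \<in> carrier A \<Longrightarrow>
      f (basis (xs @ (a \<oplus> b) # ys)) - (f (basis (xs @ a # ys)) + f (basis (xs @ b # ys))) \<in> T"
    and smult: "\<And>xs c a ys. set xs \<subseteq> carrier A \<Longrightarrow> set ys \<subseteq> carrier A \<Longrightarrow> a \<in> carrier A \<Longrightarrow>
      f (basis (xs @ (c \<odot> a) # ys)) - scale c (f (basis (xs @ a # ys))) \<in> T"
    and balanced: "\<And>xs a v b ys. set xs \<subseteq> carrier A \<Longrightarrow> set ys \<subseteq> carrier A \<Longrightarrow> a \<in> carrier A \<Longrightarrow> b \<in> carrier A \<Longrightarrow>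
      v \<in> V \<Longrightarrow> f (basis (xs @ (a \<otimes> v) # b # ys)) - f (basis (xs @ a # (v \<otimes> b) # ys)) \<in> T"
    and vanish: "\<And>x xs v ys. x \<in> carrier A \<Longrightarrow> set xs \<subseteq> carrier A \<Longrightarrow> set ys \<subseteq> carrier A \<Longrightarrow> v \<in> V \<Longrightarrow>
      f (basis (x # xs @ v # ys)) \<in> T"
  shows "f x \<in> T"
proof (rule lin_span_into[OF f T])
  fix s assume "s \<in> (\<Union>n. form_relators A V n)"
  then obtain n where "s \<in> form_relators A V n" by auto
  then consider (1) xs a b ys where "s = basis (xs @ (a \<oplus> b) # ys) - basis (xs @ a # ys) - basis (xs @ b # ys)"
      "xs @ a # ys \<in> symbols A n" "b \<in> carrier A"
    | (2) xs c a ys where "s = basis (xs @ (c \<odot> a) # ys) - scale c (basis (xs @ a # ys))"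
      "xs @ a # ys \<in> symbols A n"
    | (3) xs a v b ys where "s = basis (xs @ (a \<otimes> v) # b # ys) - basis (xs @ a # (v \<otimes> b) # ys)"
      "xs @ a # b # ys \<in> symbols A n" "v \<in> V"
    | (4) xs v ys where "s = basis (xs @ v # ys)" "xs @ v # ys \<in> symbols A n" "xs \<noteq> []" "v \<in> V"
    unfolding form_relators_def Un_iff mem_Collect_eq
    by (elim disjE exE conjE) (rule that; assumption)+
  then show "f s \<in> T"
  proof cases
    case 1
    then show ?thesis
      using add[of xs ys a b] by (simp add: lin_diff[OF f] lin_add[OF f] symbols_def diff_diff_eq)
  next
    case 2
    then show ?thesis
      using smult[of xs ys a c] by (simp add: lin_diff[OF f] lin_scale[OF f] symbols_def del: scale_single)
  next
    case 3
    then show ?thesis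
      using balanced[of xs ys a b v] by (simp add: lin_diff[OF f] symbols_def)
  next
    case 4
    then show ?thesis
      using vanish[of "hd xs" "tl xs" ys v] by (cases xs) (auto simp: symbols_def)
  qed
qed (use x in \<open>simp add: Rel_def\<close>)

lemma lin_Rel_Rel:
  assumes f: "lin f" and x: "x \<in> Rel"
    and "\<And>xs a b ys. set xs \<subseteq> carrier A \<Longrightarrow> set ys \<subseteq> carrier A \<Longrightarrow> a \<in> carrier A \<Longrightarrow> b \<in> carrier A \<Longrightarrow>
      f (basis (xs @ (a \<oplus> b) # ys)) \<approx> f (basis (xs @ a # ys)) + f (basis (xs @ b # ys))"
    and "\<And>xs c a ys. set xs \<subseteq> carrier A \<Longrightarrow> set ys \<subseteq> carrier A \<Longrightarrow> a \<in> carrier A \<Longrightarrow>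
      f (basis (xs @ (c \<odot> a) # ys)) \<approx> scale c (f (basis (xs @ a # ys)))"
    and "\<And>xs a v b ys. set xs \<subseteq> carrier A \<Longrightarrow> set ys \<subseteq> carrier A \<Longrightarrow> a \<in> carrier A \<Longrightarrow> b \<in> carrier A \<Longrightarrow>
      v \<in> V \<Longrightarrow> f (basis (xs @ (a \<otimes> v) # b # ys)) \<approx> f (basis (xs @ a # (v \<otimes> b) # ys))"
    and "\<And>x xs v ys. x \<in> carrier A \<Longrightarrow> set xs \<subseteq> carrier A \<Longrightarrow> set ys \<subseteq> carrier A \<Longrightarrow> v \<in> V \<Longrightarrow>
      f (basis (x # xs @ v # ys)) \<in> Rel"
  shows "f x \<in> Rel"
  by (rule lin_Rel_into[OF f subspace_Rel x]; rule assms(3-6)[unfolded eqv_def]; assumption)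

section \<open>Left multiplication, the differential and their commutator\<close>

definition left_mult :: "'a \<Rightarrow> ('a list \<Rightarrow>\<^sub>0 complex) \<Rightarrow> ('a list \<Rightarrow>\<^sub>0 complex)"
  where "left_mult a = lin_ext (\<lambda>bs. basis (a \<otimes> hd bs # tl bs))"

definition d_op :: "('a list \<Rightarrow>\<^sub>0 complex) \<Rightarrow> ('a list \<Rightarrow>\<^sub>0 complex)"
  where "d_op = lin_ext (symbol_d A)"

text \<open>The operator \<open>delta a = [d, L(a)]\<close> represents left multiplication by the form \<open>da\<close>.\<close>

definition delta :: "'a \<Rightarrow> ('a list \<Rightarrow>\<^sub>0 complex) \<Rightarrow> ('a list \<Rightarrow>\<^sub>0 complex)"
  where "delta a x = d_op (left_mult a x) - left_mult a (d_op x)"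

lemma lin_left_mult: "lin (left_mult a)"
  by (simp add: left_mult_def lin_lin_ext)

lemma lin_d_op: "lin d_op"
  by (simp add: d_op_def lin_lin_ext)

lemma lin_delta: "lin (delta a)"
  unfolding delta_def[abs_def] by (intro lin_minus lin_comp[OF lin_d_op lin_left_mult] lin_comp[OF lin_left_mult lin_d_op])

lemma left_mult_basis [simp]: "left_mult a (basis (b # bs)) = basis (a \<otimes> b # bs)"
  by (simp add: left_mult_def)

lemma d_op_basis [simp]: "d_op (basis bs) = basis (\<one> # bs)"
  by (simp add: d_op_def symbol_d_def)

lemma delta_basis [simp]: "a \<in> carrier A \<Longrightarrow> delta a (basis (b # bs)) = basis (\<one> # a \<otimes> b # bs) - basis (a # b # bs)"
  by (simp add: delta_def)

lemma left_mult_Free [simp]: "a \<in> carrier A \<Longrightarrow> x \<in> Free \<Longrightarrow> left_mult a x \<in> Free"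
  by (rule lin_Free_into[OF lin_left_mult subspace_Free]) auto

lemma d_op_Free [simp]: "x \<in> Free \<Longrightarrow> d_op x \<in> Free"
  by (rule lin_Free_into[OF lin_d_op subspace_Free]) auto

lemma delta_Free [simp]: "a \<in> carrier A \<Longrightarrow> x \<in> Free \<Longrightarrow> delta a x \<in> Free"
  by (simp add: delta_def)

lemma left_mult_Free_deg [simp]: "a \<in> carrier A \<Longrightarrow> x \<in> Free_deg n \<Longrightarrow> left_mult a x \<in> Free_deg n"
  by (rule lin_Free_deg_into[OF lin_left_mult subspace_Free_deg]) (auto simp: symbols_def left_mult_def length_Suc_conv)

lemma d_op_Free_deg [simp]: "x \<in> Free_deg n \<Longrightarrow> d_op x \<in> Free_deg (Suc n)"
  by (rule lin_Free_deg_into[OF lin_d_op subspace_Free_deg]) (auto simp: symbols_def)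

lemma delta_Free_deg [simp]: "a \<in> carrier A \<Longrightarrow> x \<in> Free_deg n \<Longrightarrow> delta a x \<in> Free_deg (Suc n)"
  by (simp add: delta_def)

text \<open>Only the head of a symbol changes. A relator in the first entry keeps its form by
  distributivity, bilinearity or associativity in \<open>A\<close>; a relator further to the right
  is untouched.\<close>

lemma left_mult_Rel [simp]: "a \<in> carrier A \<Longrightarrow> x \<in> Rel \<Longrightarrow> left_mult a x \<in> Rel"
proof (erule lin_Rel_Rel[OF lin_left_mult], goal_cases)
  case (1 xs b c ys)
  then show ?case
    using relator_add[of "[]" ys "a \<otimes> b" "a \<otimes> c"] relator_add[of "a \<otimes> hd xs # tl xs" ys b c]
    by (cases xs) (auto simp: r_distr)
next
  case (2 xs c b ys)
  then show ?case
    using relator_smult[of "[]" ys "a \<otimes> b" c] relator_smult[of "a \<otimes> hd xs # tl xs" ys b c]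
    by (cases xs) (auto simp: smult_mult_right)
next
  case (3 xs b v c ys)
  then show ?case
    using relator_balanced[of "[]" ys "a \<otimes> b" c v] relator_balanced[of "a \<otimes> hd xs # tl xs" ys b c v]
    by (cases xs) (auto simp: m_assoc)
next
  case (4 x xs v ys)
  then show ?case
    using relator_V[of "a \<otimes> x # xs" ys v] by auto
qed

lemma d_op_Rel [simp]: "x \<in> Rel \<Longrightarrow> d_op x \<in> Rel"
proof (erule lin_Rel_Rel[OF lin_d_op], goal_cases)
  case (1 xs b c ys)
  then show ?case
    using relator_add[of "\<one> # xs" ys b c] by auto
next
  case (2 xs c b ys)
  then show ?case
    using relator_smult[of "\<one> # xs" ys b c] by auto
next
  case (3 xs b v c ys)
  then show ?case
    using relator_balanced[of "\<one> # xs" ys b c v] by auto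
next
  case (4 x xs v ys)
  then show ?case
    using relator_V[of "\<one> # x # xs" ys v] by auto
qed

lemma delta_Rel [simp]: "a \<in> carrier A \<Longrightarrow> x \<in> Rel \<Longrightarrow> delta a x \<in> Rel"
  by (simp add: delta_def)

lemma eqv_left_mult: "a \<in> carrier A \<Longrightarrow> x \<approx> y \<Longrightarrow> left_mult a x \<approx> left_mult a y"
  by (rule eqv_lin[OF lin_left_mult left_mult_Rel])

lemma eqv_d_op: "x \<approx> y \<Longrightarrow> d_op x \<approx> d_op y"
  by (rule eqv_lin[OF lin_d_op d_op_Rel])

lemma eqv_delta: "a \<in> carrier A \<Longrightarrow> x \<approx> y \<Longrightarrow> delta a x \<approx> delta a y"
  by (rule eqv_lin[OF lin_delta delta_Rel])

lemma left_mult_left_mult: "a \<in> carrier A \<Longrightarrow> b \<in> carrier A \<Longrightarrow> x \<in> Free \<Longrightarrow> left_mult a (left_mult b x) = left_mult (a \<otimes> b) x"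
  by (rule lin_Free_eq[OF lin_comp[OF lin_left_mult lin_left_mult] lin_left_mult]) (simp_all add: m_assoc)

lemma left_mult_one [simp]: "x \<in> Free \<Longrightarrow> left_mult \<one> x = x"
  by (rule lin_Free_eq[OF lin_left_mult lin_ident]) simp_all

text \<open>Applying \<open>d_op\<close> twice puts \<open>\<one>\<close>, an element of
  \<open>V\<close>, into the second entry.\<close>

lemma d_op_d_op: "x \<in> Free \<Longrightarrow> d_op (d_op x) \<in> Rel"
  by (rule lin_Free_into[OF lin_comp[OF lin_d_op lin_d_op] subspace_Rel])
    (use relator_V[of "[\<one>]" _ \<one>] one_in_V in auto)

text \<open>Both sides reduce to - d L(a) d once d d is a relation.\<close>

lemma d_op_delta: "a \<in> carrier A \<Longrightarrow> x \<in> Free \<Longrightarrow> d_op (delta a x) \<approx> - delta a (d_op x)"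
  by (simp add: eqv_def delta_def lin_diff[OF lin_d_op] d_op_d_op)

text \<open>The commutator with d is a derivation and L(a) L(b) = L(ab). This is an exact equality,
  not only a congruence.\<close>

lemma delta_mult:
  "a \<in> carrier A \<Longrightarrow> b \<in> carrier A \<Longrightarrow> x \<in> Free \<Longrightarrow> delta (a \<otimes> b) x = left_mult a (delta b x) + delta a (left_mult b x)"
  by (simp add: delta_def lin_diff[OF lin_left_mult] left_mult_left_mult[symmetric])

text \<open>On a symbol \<open>b # bs\<close> the two terms of \<open>delta v\<close> are the two
  sides of the balancing relator at the first tensor sign, with \<open>\<one>\<close> to the left of
  \<open>v\<close>.\<close>

lemma delta_V: "v \<in> V \<Longrightarrow> x \<in> Free \<Longrightarrow> delta v x \<in> Rel"
proof (erule lin_Free_into[OF lin_delta subspace_Rel, rotated])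
  fix b bs
  assume "v \<in> V" "b # bs \<in> Symbols"
  then show "delta v (basis (b # bs)) \<in> Rel"
    using eqv_sym[OF relator_balanced[of "[]" bs \<one> b v]] by (simp add: eqv_def)
qed

lemma left_mult_add:
  "a \<in> carrier A \<Longrightarrow> b \<in> carrier A \<Longrightarrow> x \<in> Free \<Longrightarrow> left_mult (a \<oplus> b) x \<approx> left_mult a x + left_mult b x"
proof (erule lin_Free_eqv[OF lin_left_mult lin_plus[OF lin_left_mult lin_left_mult], rotated])
  fix c cs
  assume "a \<in> carrier A" "b \<in> carrier A" "c # cs \<in> Symbols"
  then show "left_mult (a \<oplus> b) (basis (c # cs)) \<approx> left_mult a (basis (c # cs)) + left_mult b (basis (c # cs))"
    using relator_add[of "[]" cs "a \<otimes> c" "b \<otimes> c"] by (simp add: l_distr)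
qed

lemma left_mult_smult: "a \<in> carrier A \<Longrightarrow> x \<in> Free \<Longrightarrow> left_mult (c \<odot> a) x \<approx> scale c (left_mult a x)"
proof (erule lin_Free_eqv[OF lin_left_mult lin_scaled[OF lin_left_mult], rotated])
  fix b bs
  assume "a \<in> carrier A" "b # bs \<in> Symbols"
  then show "left_mult (c \<odot> a) (basis (b # bs)) \<approx> scale c (left_mult a (basis (b # bs)))"
    using relator_smult[of "[]" bs "a \<otimes> b" c] by (simp add: smult_mult_left)
qed

lemma delta_add:
  assumes "a \<in> carrier A" "b \<in> carrier A" "x \<in> Free"
  shows "delta (a \<oplus> b) x \<approx> delta a x + delta b x"
  using eqv_diff[OF eqv_d_op[OF left_mult_add[OF assms]] left_mult_add[OF assms(1,2) d_op_Free[OF assms(3)]]]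
  by (simp add: delta_def lin_add[OF lin_d_op] algebra_simps)

lemma delta_smult:
  assumes "a \<in> carrier A" "x \<in> Free"
  shows "delta (c \<odot> a) x \<approx> scale c (delta a x)"
  using eqv_diff[OF eqv_d_op[OF left_mult_smult[OF assms, of c]] left_mult_smult[OF assms(1) d_op_Free[OF assms(2)], of c]]
  by (simp add: delta_def lin_scale[OF lin_d_op] pm.scale_right_diff_distrib)

end

section \<open>The product of forms\<close>

context relative_algebra begin

lemma lin_Free_deg_eqv:
  assumes "lin f" and "lin g" and "\<And>a as. a # as \<in> symbols A n \<Longrightarrow> f (basis (a # as)) \<approx> g (basis (a # as))" and "x \<in> Free_deg n"
  shows "f x \<approx> g x"
  unfolding eqv_def
proof (rule lin_Free_deg_into[OF lin_minus[OF assms(1,2)] subspace_Rel _ assms(4)])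
  fix as assume "as \<in> symbols A n"
  then show "f (basis as) - g (basis as) \<in> Rel"
    using assms(3) by (cases as) (auto simp: eqv_def symbols_def)
qed

primrec delta_list :: "'a list \<Rightarrow> ('a list \<Rightarrow>\<^sub>0 complex) \<Rightarrow> ('a list \<Rightarrow>\<^sub>0 complex)"
  where
    "delta_list [] y = y"
  | "delta_list (a # as) y = delta a (delta_list as y)"

definition prod_op :: "('a list \<Rightarrow>\<^sub>0 complex) \<Rightarrow> ('a list \<Rightarrow>\<^sub>0 complex) \<Rightarrow> ('a list \<Rightarrow>\<^sub>0 complex)"
  where "prod_op x y = lin_ext (\<lambda>as. left_mult (hd as) (delta_list (tl as) y)) x"

lemma lin_delta_list: "lin (delta_list as)"
proof (induction as)
  case Nil
  have "delta_list [] = (\<lambda>y. y)" by (rule ext) simp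
  then show ?case by (simp add: lin_ident)
next
  case (Cons a as)
  then show ?case using lin_comp[OF lin_delta Cons] by simp
qed

lemma delta_list_append: "delta_list (xs @ ys) y = delta_list xs (delta_list ys y)"
  by (induction xs) auto

lemma delta_list_Free [simp]: "set as \<subseteq> carrier A \<Longrightarrow> y \<in> Free \<Longrightarrow> delta_list as y \<in> Free"
  by (induction as) auto

lemma delta_list_Rel [simp]: "set as \<subseteq> carrier A \<Longrightarrow> y \<in> Rel \<Longrightarrow> delta_list as y \<in> Rel"
  by (induction as) auto

lemma delta_list_Free_deg [simp]: "set as \<subseteq> carrier A \<Longrightarrow> y \<in> Free_deg n \<Longrightarrow> delta_list as y \<in> Free_deg (length as + n)"
  by (induction as) auto

lemma prod_op_basis [simp]: "prod_op (basis (a # as)) y = left_mult a (delta_list as y)"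
  by (simp add: prod_op_def)

lemma lin_prod_op_left: "lin (\<lambda>x. prod_op x y)"
  unfolding prod_op_def by (rule lin_lin_ext)

lemma lin_prod_op_right: "lin (prod_op x)"
  unfolding prod_op_def by (rule lin_ext_fun[of UNIV]) (auto intro: lin_comp[OF lin_left_mult lin_delta_list])

lemma prod_op_Free [simp]: "x \<in> Free \<Longrightarrow> y \<in> Free \<Longrightarrow> prod_op x y \<in> Free"
  by (rule lin_Free_into[OF lin_prod_op_left subspace_Free]) auto

lemma prod_op_Free_deg:
  assumes "x \<in> Free_deg i" "y \<in> Free_deg j" shows "prod_op x y \<in> Free_deg (i + j)"
proof (rule lin_Free_deg_into[OF lin_prod_op_left subspace_Free_deg _ assms(1)])
  fix as assume "as \<in> symbols A i"
  then show "prod_op (basis as) y \<in> Free_deg (i + j)"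
    using assms(2) by (cases as) (auto simp: symbols_def)
qed

lemma prod_op_Rel_right: "x \<in> Free \<Longrightarrow> y \<in> Rel \<Longrightarrow> prod_op x y \<in> Rel"
  by (rule lin_Free_into[OF lin_prod_op_left subspace_Rel]) auto

text \<open>Each family of relators corresponds to a property of L and \<open>delta\<close>: the
  linear ones to their additivity and homogeneity in the algebra element, balancing to the Leibniz
  rule together with \<open>delta_V\<close>, and vanishing to \<open>delta_V\<close> alone.\<close>

lemma prod_op_Rel_left:
  assumes y: "y \<in> Free" and x: "x \<in> Rel"
  shows "prod_op x y \<in> Rel"
proof (rule lin_Rel_Rel[OF lin_prod_op_left x], goal_cases)
  case (1 xs a b ys)
  have z: "delta_list ys y \<in> Free" using 1 y by simp
  show ?case
  proof (cases xs)
    case Nil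
    then show ?thesis using left_mult_add[OF 1(3,4) z] by simp
  next
    case (Cons x xs')
    then have "left_mult x (delta_list xs' (delta (a \<oplus> b) (delta_list ys y))) \<approx> left_mult x (delta_list xs' (delta a (delta_list ys y) + delta b (delta_list ys y)))"
      using 1 by (intro eqv_left_mult eqv_lin[OF lin_delta_list delta_list_Rel] delta_add z) auto
    then show ?thesis
      using Cons by (simp add: delta_list_append lin_add[OF lin_delta_list] lin_add[OF lin_left_mult])
  qed
next
  case (2 xs c a ys)
  have z: "delta_list ys y \<in> Free" using 2 y by simp
  show ?case
  proof (cases xs)
    case Nil
    then show ?thesis using left_mult_smult[OF 2(3) z] by simp
  next
    case (Cons x xs')
    then have "left_mult x (delta_list xs' (delta (c \<odot> a) (delta_list ys y))) \<approx> left_mult x (delta_list xs' (scale c (delta a (delta_list ys y))))"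
      using 2 by (intro eqv_left_mult eqv_lin[OF lin_delta_list delta_list_Rel] delta_smult z) auto
    then show ?thesis
      using Cons by (simp add: delta_list_append lin_scale[OF lin_delta_list] lin_scale[OF lin_left_mult])
  qed
next
  case (3 xs a v b ys)
  have z: "delta_list ys y \<in> Free" using 3 y by simp
  have v: "v \<in> carrier A" using 3 by simp
  have vb: "delta (v \<otimes> b) (delta_list ys y) = left_mult v (delta b (delta_list ys y)) + delta v (left_mult b (delta_list ys y))"
    by (rule delta_mult) (use 3 z in auto)
  have av: "delta (a \<otimes> v) (delta b (delta_list ys y)) = left_mult a (delta v (delta b (delta_list ys y))) + delta a (left_mult v (delta b (delta_list ys y)))"
    by (rule delta_mult) (use 3 z in auto)
  have r1: "delta v (left_mult b (delta_list ys y)) \<in> Rel" "delta v (delta b (delta_list ys y)) \<in> Rel"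
    using 3 z by (auto intro: delta_V)
  show ?case
  proof (cases xs)
    case Nil
    have "left_mult (a \<otimes> v) (delta b (delta_list ys y)) = left_mult a (left_mult v (delta b (delta_list ys y)))"
      using 3 z by (simp add: left_mult_left_mult)
    also have "\<dots> \<approx> left_mult a (delta (v \<otimes> b) (delta_list ys y))"
      using r1 3 unfolding vb by (intro eqv_left_mult) (auto simp: eqv_def)
    finally show ?thesis using Nil by simp
  next
    case (Cons x xs')
    \<comment> \<open>The common term \<open>delta a\<close> L(v) \<open>delta b\<close> of the two
      Leibniz expansions cancels; each remaining term contains a factor
      \<open>delta v\<close>.\<close>
    have "delta (a \<otimes> v) (delta b (delta_list ys y)) - delta a (delta (v \<otimes> b) (delta_list ys y))
        = left_mult a (delta v (delta b (delta_list ys y))) - delta a (delta v (left_mult b (delta_list ys y)))"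
      unfolding av vb by (simp add: lin_add[OF lin_delta])
    also have "\<dots> \<in> Rel" using r1 3 by simp
    finally have "left_mult x (delta_list xs' (delta (a \<otimes> v) (delta b (delta_list ys y)))) \<approx> left_mult x (delta_list xs' (delta a (delta (v \<otimes> b) (delta_list ys y))))"
      using 3 Cons by (intro eqv_left_mult eqv_lin[OF lin_delta_list delta_list_Rel]) (auto simp: eqv_def)
    then show ?thesis
      using Cons by (simp add: delta_list_append)
  qed
next
  case (4 x xs v ys)
  then show ?case using y by (simp add: delta_list_append delta_V)
qed

lemma d_op_delta_list:
  assumes "set as \<subseteq> carrier A" "y \<in> Free"
  shows "d_op (delta_list as y) \<approx> scale ((-1) ^ length as) (delta_list as (d_op y))"
  using assms
proof (induction as)
  case (Cons a as)
  have "d_op (delta_list (a # as) y) \<approx> - delta a (d_op (delta_list as y))"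
    using Cons by (simp add: d_op_delta)
  also have "\<dots> = scale (- 1) (delta a (d_op (delta_list as y)))" by simp
  also have "\<dots> \<approx> scale (- 1) (delta a (scale ((-1) ^ length as) (delta_list as (d_op y))))"
    using Cons by (intro eqv_scale eqv_delta) auto
  also have "\<dots> = scale ((-1) ^ length (a # as)) (delta_list (a # as) (d_op y))"
    by (simp add: lin_scale[OF lin_delta])
  finally show ?case .
qed simp

text \<open>Applied to a symbol with head \<open>\<one>\<close>, \<open>delta a\<close> inserts
  \<open>a\<close> behind the head; its second term has \<open>\<one>\<close> behind
  \<open>a\<close> and is a relation.\<close>

lemma delta_list_one_Cons:
  assumes "set as \<subseteq> carrier A" "set bs \<subseteq> carrier A"
  shows "delta_list as (basis (\<one> # bs)) \<approx> basis (\<one> # as @ bs)"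
  using assms
proof (induction as)
  case (Cons a as)
  have "delta_list (a # as) (basis (\<one> # bs)) \<approx> delta a (basis (\<one> # as @ bs))"
    using Cons.IH Cons.prems unfolding delta_list.simps by (intro eqv_delta) auto
  also have "\<dots> \<approx> basis (\<one> # a # as @ bs)"
    using Cons relator_V[of "[a]" "as @ bs" \<one>] one_in_V by (simp add: eqv_def)
  finally show ?case by simp
qed simp

lemma symbol_mult_single: "symbol_mult A [a] (b # bs) = basis (a \<otimes> b # bs)"
  by (simp add: symbol_mult_def contract_def)

text \<open>The summand that contracts \<open>a\<close> with \<open>a'\<close> stands apart. Every
  other summand leaves \<open>a\<close> in front and contracts inside the tail, and prefixing
  \<open>a\<close> is L(a) d.\<close>

lemma symbol_mult_Cons:
  assumes "a \<in> carrier A"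
  shows "symbol_mult A (a # a' # as) bs
    = left_mult a (d_op (symbol_mult A (a' # as) bs)) + scale ((-1) ^ Suc (length as)) (basis (a \<otimes> a' # as @ bs))"
proof -
  have LD: "left_mult a (d_op (basis cs)) = basis (a # cs)" for cs
    using assms by simp
  have "left_mult a (d_op (symbol_mult A (a' # as) bs))
      = (\<Sum>i=0..length as. scale ((-1) ^ (length as - i)) (basis (a # contract A i ((a' # as) @ bs))))"
    unfolding symbol_mult_def Let_def
    by (simp add: module_hom.sum[OF lin_left_mult] module_hom.sum[OF lin_d_op] lin_scale[OF lin_left_mult]
        lin_scale[OF lin_d_op] LD del: scale_single d_op_basis)
  moreover have "contract A (Suc i) (a # cs) = a # contract A i cs" for i cs
    by (simp add: contract_def)
  moreover have "symbol_mult A (a # a' # as) bs = (\<Sum>i=0..Suc (length as).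
      scale ((-1) ^ (Suc (length as) - i)) (basis (contract A i (a # (a' # as) @ bs))))"
    unfolding symbol_mult_def Let_def by (simp del: scale_single sum.cl_ivl_Suc)
  moreover have "contract A 0 (a # (a' # as) @ bs) = a \<otimes> a' # as @ bs"
    by (simp add: contract_def)
  ultimately show ?thesis
    unfolding sum.atLeast0_atMost_Suc_shift
    by (simp add: add.commute del: scale_single sum.cl_ivl_Suc append_Cons)
qed

text \<open>In L(a) [d, L(a')] z, with z the product of the remaining differentials and
  \<open>bs\<close>, the term L(a) d L(a') z is the induction hypothesis with \<open>a\<close>
  prefixed. In L(a) L(a') d z, moving d past the differentials produces the sign, and what is left
  is the one summand that contracts \<open>a\<close> with \<open>a'\<close>.\<close>

lemma symbol_mult_eqv:
  assumes "a \<in> carrier A" "set as \<subseteq> carrier A" "bs \<in> Symbols"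
  shows "symbol_mult A (a # as) bs \<approx> prod_op (basis (a # as)) (basis bs)"
  using assms
proof (induction as arbitrary: a)
  case Nil
  then show ?case
    by (cases bs) (auto simp: symbol_mult_single Symbols_def)
next
  case (Cons a' as)
  let ?z = "delta_list as (basis bs)"
  have z: "?z \<in> Free" using Cons by simp
  have bs: "set bs \<subseteq> carrier A" using Cons by (simp add: Symbols_def)
  have "d_op ?z \<approx> scale ((-1) ^ length as) (delta_list as (basis (\<one> # bs)))"
    using d_op_delta_list[of as "basis bs"] Cons by simp
  also have "\<dots> \<approx> scale ((-1) ^ length as) (basis (\<one> # as @ bs))"
    using Cons bs by (intro eqv_scale delta_list_one_Cons) auto
  finally have "left_mult a (left_mult a' (d_op ?z)) \<approx> left_mult a (left_mult a' (scale ((-1) ^ length as) (basis (\<one> # as @ bs))))"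
    using Cons by (intro eqv_left_mult) auto
  also have "\<dots> = scale ((-1) ^ length as) (basis (a \<otimes> a' # as @ bs))"
    using Cons by (simp add: lin_scale[OF lin_left_mult] del: scale_single)
  finally have 1: "left_mult a (left_mult a' (d_op ?z)) \<approx> scale ((-1) ^ length as) (basis (a \<otimes> a' # as @ bs))" .
  have 2: "left_mult a (d_op (symbol_mult A (a' # as) bs)) \<approx> left_mult a (d_op (left_mult a' ?z))"
    using Cons.IH[of a'] Cons.prems by (intro eqv_left_mult eqv_d_op) auto
  have "symbol_mult A (a # a' # as) bs
      = left_mult a (d_op (symbol_mult A (a' # as) bs)) - scale ((-1) ^ length as) (basis (a \<otimes> a' # as @ bs))"
    using Cons by (simp add: symbol_mult_Cons single_uminus)
  also have "\<dots> \<approx> left_mult a (d_op (left_mult a' ?z)) - left_mult a (left_mult a' (d_op ?z))"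
    by (intro eqv_diff 2 eqv_sym[OF 1])
  also have "\<dots> = prod_op (basis (a # a' # as)) (basis bs)"
    by (simp add: delta_def lin_diff[OF lin_left_mult])
  finally show ?case .
qed

lemma bilin_ext_symbol_mult_eqv:
  assumes x: "x \<in> Free" and y: "y \<in> Free"
  shows "bilin_ext (symbol_mult A) x y \<approx> prod_op x y"
proof (rule lin_Free_eqv[OF lin_bilin_ext_left lin_prod_op_left _ x])
  fix a as assume as: "a # as \<in> Symbols"
  show "bilin_ext (symbol_mult A) (basis (a # as)) y \<approx> prod_op (basis (a # as)) y"
    by (rule lin_Free_eqv[OF lin_bilin_ext_right lin_prod_op_right _ y])
      (use as symbol_mult_eqv in \<open>auto simp del: prod_op_basis\<close>)
qed

text \<open>Since d L(a) = \<open>delta a\<close> + L(a) d, the first term is the product with the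
  differential of the left factor, and in the second d passes one anticommuting \<open>delta\<close>
  for each further entry.\<close>

lemma d_op_prod_op:
  assumes x: "x \<in> Free_deg i" and y: "y \<in> Free"
  shows "d_op (prod_op x y) \<approx> prod_op (d_op x) y + scale ((-1) ^ i) (prod_op x (d_op y))"
proof (rule lin_Free_deg_eqv[OF lin_comp[OF lin_d_op lin_prod_op_left]
      lin_plus[OF lin_comp[OF lin_prod_op_left lin_d_op] lin_scaled[OF lin_prod_op_left]] _ x])
  fix a as assume as: "a # as \<in> symbols A i"
  then have c: "a \<in> carrier A" "set as \<subseteq> carrier A" "length as = i" by (auto simp: symbols_def)
  have "d_op (left_mult a (delta_list as y)) = delta a (delta_list as y) + left_mult a (d_op (delta_list as y))"
    by (simp add: delta_def)
  also have "\<dots> \<approx> delta a (delta_list as y) + left_mult a (scale ((-1) ^ i) (delta_list as (d_op y)))"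
    using d_op_delta_list[of as y] c y by (intro eqv_add eqv_left_mult) auto
  finally show "d_op (prod_op (basis (a # as)) y) \<approx> prod_op (d_op (basis (a # as))) y + scale ((-1) ^ i) (prod_op (basis (a # as)) (d_op y))"
    using c y by (simp add: lin_scale[OF lin_left_mult])
qed

end

section \<open>Contraction with a derivation\<close>

locale relative_derivation = relative_algebra +
  fixes \<theta> :: "'a \<Rightarrow> 'a"
  assumes theta_carrier [simp]: "a \<in> carrier A \<Longrightarrow> \<theta> a \<in> carrier A"
    and theta_add: "a \<in> carrier A \<Longrightarrow> b \<in> carrier A \<Longrightarrow> \<theta> (a \<oplus> b) = \<theta> a \<oplus> \<theta> b"
    and theta_smult: "a \<in> carrier A \<Longrightarrow> \<theta> (c \<odot> a) = c \<odot> \<theta> a"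
    and theta_mult: "a \<in> carrier A \<Longrightarrow> b \<in> carrier A \<Longrightarrow> \<theta> (a \<otimes> b) = \<theta> a \<otimes> b \<oplus> a \<otimes> \<theta> b"
    and theta_V: "v \<in> V \<Longrightarrow> \<theta> v = \<zero>"
begin

text \<open>\<open>iota_d [a\<^sub>1, \<dots>, a\<^sub>n]\<close> is the contraction of \<open>da\<^sub>1 \<cdots> da\<^sub>n\<close>.\<close>

primrec iota_d :: "'a list \<Rightarrow> ('a list \<Rightarrow>\<^sub>0 complex)"
  where
    "iota_d [] = 0"
  | "iota_d (a # as) = basis (\<theta> a # as) - delta a (iota_d as)"

definition iota :: "('a list \<Rightarrow>\<^sub>0 complex) \<Rightarrow> ('a list \<Rightarrow>\<^sub>0 complex)"
  where "iota = lin_ext (\<lambda>as. left_mult (hd as) (iota_d (tl as)))"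

lemma lin_iota: "lin iota"
  by (simp add: iota_def lin_lin_ext)

lemma iota_basis [simp]: "iota (basis (a # as)) = left_mult a (iota_d as)"
  by (simp add: iota_def)

lemma iota_d_Free [simp]: "set as \<subseteq> carrier A \<Longrightarrow> iota_d as \<in> Free"
  by (induction as) auto

lemma iota_d_Free_deg: "set as \<subseteq> carrier A \<Longrightarrow> iota_d as \<in> Free_deg (length as - 1)"
proof (induction as)
  case (Cons a as)
  have "delta a (iota_d as) \<in> Free_deg (length as)"
  proof (cases as)
    \<comment> \<open>Truncated subtraction gives the empty list degree 0, so
      \<open>delta_Free_deg\<close> would only yield degree 1; but the contraction is zero here and
      lies in every degree.\<close>
    case Nil
    then show ?thesis by (simp add: lin_zero[OF lin_delta])
  next
    case (Cons b bs)
    then show ?thesis using Cons.IH Cons.prems delta_Free_deg[of a "iota_d as" "length bs"] by simp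
  qed
  then show ?case using Cons by (auto simp: symbols_def)
qed simp

lemma iota_Free [simp]: "x \<in> Free \<Longrightarrow> iota x \<in> Free"
  by (rule lin_Free_into[OF lin_iota subspace_Free]) auto

lemma iota_Free_deg: "x \<in> Free_deg n \<Longrightarrow> iota x \<in> Free_deg (n - 1)"
proof (rule lin_Free_deg_into[OF lin_iota subspace_Free_deg])
  fix as assume "as \<in> symbols A n"
  then show "iota (basis as) \<in> Free_deg (n - 1)"
    using iota_d_Free_deg[of "tl as"] by (cases as) (auto simp: symbols_def)
qed

lemma iota_Free_deg_0: "x \<in> Free_deg 0 \<Longrightarrow> iota x = 0"
proof -
  assume "x \<in> Free_deg 0"
  then have "iota x \<in> {0}"
  proof (rule lin_Free_deg_into[OF lin_iota pm.subspace_single_0, rotated])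
    fix as assume "as \<in> symbols A 0"
    then show "iota (basis as) \<in> {0}"
      by (cases as) (auto simp: symbols_def lin_zero[OF lin_left_mult])
  qed
  then show ?thesis by simp
qed

lemma iota_d_add:
  assumes "set xs \<subseteq> carrier A" "set ys \<subseteq> carrier A" "a \<in> carrier A" "b \<in> carrier A"
  shows "iota_d (xs @ (a \<oplus> b) # ys) \<approx> iota_d (xs @ a # ys) + iota_d (xs @ b # ys)"
  using assms
proof (induction xs)
  case Nil
  then show ?case
    using eqv_diff[OF relator_add[of "[]" ys "\<theta> a" "\<theta> b"] delta_add[of a b "iota_d ys"]]
    by (simp add: theta_add algebra_simps)
next
  case (Cons x xs)
  then have "iota_d (xs @ (a \<oplus> b) # ys) \<approx> iota_d (xs @ a # ys) + iota_d (xs @ b # ys)" and x: "x \<in> carrier A" by auto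
  from eqv_diff[OF relator_add[of "\<theta> x # xs" ys a b] eqv_delta[OF x this(1)]] Cons.prems
  show ?case
    by (simp add: lin_add[OF lin_delta] algebra_simps)
qed

lemma iota_d_smult:
  assumes "set xs \<subseteq> carrier A" "set ys \<subseteq> carrier A" "a \<in> carrier A"
  shows "iota_d (xs @ (c \<odot> a) # ys) \<approx> scale c (iota_d (xs @ a # ys))"
  using assms
proof (induction xs)
  case Nil
  then show ?case
    using eqv_diff[OF relator_smult[of "[]" ys "\<theta> a" c] delta_smult[of a "iota_d ys" c]]
    by (simp add: theta_smult pm.scale_right_diff_distrib)
next
  case (Cons x xs)
  then have "iota_d (xs @ (c \<odot> a) # ys) \<approx> scale c (iota_d (xs @ a # ys))" and x: "x \<in> carrier A" by auto
  from eqv_diff[OF relator_smult[of "\<theta> x # xs" ys a c] eqv_delta[OF x this(1)]] Cons.prems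
  show ?case
    by (simp add: lin_scale[OF lin_delta] pm.scale_right_diff_distrib)
qed

text \<open>As \<open>\<theta> v\<close> is zero, both \<theta> and \<open>delta\<close> commute
  with left multiplication by \<open>v\<close>, the latter modulo relations. Both cases of balancing
  at the head of a symbol use this.\<close>

lemma iota_d_V_mult:
  assumes "set ys \<subseteq> carrier A" "v \<in> V" "b \<in> carrier A"
  shows "iota_d ((v \<otimes> b) # ys) \<approx> left_mult v (iota_d (b # ys))"
proof -
  have "delta (v \<otimes> b) (iota_d ys) = left_mult v (delta b (iota_d ys)) + delta v (left_mult b (iota_d ys))"
    using assms by (simp add: delta_mult)
  moreover have "delta v (left_mult b (iota_d ys)) \<in> Rel"
    using assms by (simp add: delta_V)
  ultimately show ?thesis
    using assms by (simp add: eqv_def theta_mult theta_V lin_diff[OF lin_left_mult])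
qed

lemma iota_d_balanced:
  assumes "set xs \<subseteq> carrier A" "set ys \<subseteq> carrier A" "a \<in> carrier A" "b \<in> carrier A" "v \<in> V"
  shows "iota_d (xs @ (a \<otimes> v) # b # ys) \<approx> iota_d (xs @ a # (v \<otimes> b) # ys)"
  using assms
proof (induction xs)
  case Nil
  let ?z = "iota_d (b # ys)"
  have z: "?z \<in> Free" by (rule iota_d_Free) (use Nil in auto)
  have "delta (a \<otimes> v) ?z = left_mult a (delta v ?z) + delta a (left_mult v ?z)"
    using Nil z by (intro delta_mult) auto
  moreover have "left_mult a (delta v ?z) \<in> Rel"
    using Nil z by (intro left_mult_Rel delta_V) auto
  ultimately have "delta (a \<otimes> v) ?z \<approx> delta a (left_mult v ?z)"
    by (simp add: eqv_def)
  also have "\<dots> \<approx> delta a (iota_d ((v \<otimes> b) # ys))"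
    using Nil by (intro eqv_delta eqv_sym[OF iota_d_V_mult]) auto
  finally have "delta (a \<otimes> v) ?z \<approx> delta a (iota_d ((v \<otimes> b) # ys))" .
  moreover have "basis (\<theta> (a \<otimes> v) # b # ys) \<approx> basis (\<theta> a # (v \<otimes> b) # ys)"
    using Nil relator_balanced[of "[]" ys "\<theta> a" b v] by (simp add: theta_mult theta_V)
  ultimately show ?case
    unfolding append_Nil iota_d.simps(2)[of "a \<otimes> v"] iota_d.simps(2)[of a] by (intro eqv_diff)
next
  case (Cons x xs)
  then have "iota_d (xs @ (a \<otimes> v) # b # ys) \<approx> iota_d (xs @ a # (v \<otimes> b) # ys)" and x: "x \<in> carrier A" by auto
  from eqv_diff[OF relator_balanced[of "\<theta> x # xs" ys a b v] eqv_delta[OF x this(1)]] Cons.prems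
  show ?case
    by simp
qed

text \<open>If \<open>v\<close> is the entry being contracted, \<open>\<theta> v\<close> is zero and
  \<open>delta v\<close> is a relation; otherwise \<open>v\<close> remains behind the first
  entry.\<close>

lemma iota_d_V:
  assumes "set xs \<subseteq> carrier A" "set ys \<subseteq> carrier A" "v \<in> V"
  shows "iota_d (xs @ v # ys) \<in> Rel"
  using assms
proof (induction xs)
  case Nil
  then show ?case
    using relator_zero[of "[]" ys] by (simp add: theta_V delta_V)
next
  case (Cons x xs)
  then show ?case
    using relator_V[of "\<theta> x # xs" ys v] by simp
qed

lemma iota_Rel [simp]: "x \<in> Rel \<Longrightarrow> iota x \<in> Rel"
proof (erule lin_Rel_Rel[OF lin_iota], goal_cases)
  case (1 xs a b ys)
  then show ?case
  proof (cases xs)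
    case Nil
    then show ?thesis using 1 by (simp add: left_mult_add)
  next
    case (Cons x xs')
    then show ?thesis
      using 1 eqv_left_mult[OF _ iota_d_add[of xs' ys a b], of x] by (simp add: lin_add[OF lin_left_mult])
  qed
next
  case (2 xs c a ys)
  then show ?case
  proof (cases xs)
    case Nil
    then show ?thesis using 2 by (simp add: left_mult_smult)
  next
    case (Cons x xs')
    then show ?thesis
      using 2 eqv_left_mult[OF _ iota_d_smult[of xs' ys a c], of x] by (simp add: lin_scale[OF lin_left_mult])
  qed
next
  case (3 xs a v b ys)
  then show ?case
  proof (cases xs)
    case Nil
    have "left_mult (a \<otimes> v) (iota_d (b # ys)) = left_mult a (left_mult v (iota_d (b # ys)))"
      using 3 by (intro left_mult_left_mult[symmetric] iota_d_Free) auto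
    also have "\<dots> \<approx> left_mult a (iota_d ((v \<otimes> b) # ys))"
      using 3 by (intro eqv_left_mult eqv_sym[OF iota_d_V_mult]) auto
    finally show ?thesis using Nil by simp
  next
    case (Cons x xs')
    then show ?thesis
      using 3 eqv_left_mult[OF _ iota_d_balanced[of xs' ys a b v], of x] by simp
  qed
next
  case (4 x xs v ys)
  then show ?case by (simp add: iota_d_V)
qed

section \<open>The superderivation rule for contraction\<close>

lemma iota_left_mult:
  assumes "a \<in> carrier A" "x \<in> Free"
  shows "iota (left_mult a x) = left_mult a (iota x)"
  by (rule lin_Free_eq[OF lin_comp[OF lin_iota lin_left_mult] lin_comp[OF lin_left_mult lin_iota] _ assms(2)])
    (use assms in \<open>simp add: left_mult_left_mult\<close>)

text \<open>Contracting d(ab) brings in both the derivation rule of \<theta> and the Leibniz rule of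
  \<open>delta\<close>. The terms in which \<open>a\<close> is a left factor cancel against the
  contraction of \<open>a # b # bs\<close>.\<close>

lemma iota_delta:
  assumes "a \<in> carrier A" "x \<in> Free"
  shows "iota (delta a x) \<approx> left_mult (\<theta> a) x - delta a (iota x)"
proof (rule lin_Free_eqv[OF lin_comp[OF lin_iota lin_delta] lin_minus[OF lin_left_mult lin_comp[OF lin_delta lin_iota]] _ assms(2)])
  fix b bs assume b: "b # bs \<in> Symbols"
  have d: "delta (a \<otimes> b) (iota_d bs) = left_mult a (delta b (iota_d bs)) + delta a (left_mult b (iota_d bs))"
    using assms b by (simp add: delta_mult)
  have "iota (delta a (basis (b # bs))) = left_mult \<one> (iota_d (a \<otimes> b # bs)) - left_mult a (iota_d (b # bs))"
    using assms by (simp add: lin_diff[OF lin_iota])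
  also have "left_mult \<one> (iota_d (a \<otimes> b # bs)) = iota_d (a \<otimes> b # bs)"
    by (intro left_mult_one iota_d_Free) (use assms b in auto)
  also have "iota_d (a \<otimes> b # bs) - left_mult a (iota_d (b # bs))
      = basis (\<theta> (a \<otimes> b) # bs) - basis (a \<otimes> \<theta> b # bs) - delta a (left_mult b (iota_d bs))"
    by (simp add: d lin_diff[OF lin_left_mult])
  also have "\<dots> \<approx> left_mult (\<theta> a) (basis (b # bs)) - delta a (iota (basis (b # bs)))"
    using relator_add[of "[]" bs "\<theta> a \<otimes> b" "a \<otimes> \<theta> b"] assms b
    by (simp add: theta_mult eqv_def algebra_simps)
  finally show "iota (delta a (basis (b # bs))) \<approx> left_mult (\<theta> a) (basis (b # bs)) - delta a (iota (basis (b # bs)))" .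
qed

lemma prod_op_left_mult:
  assumes "a \<in> carrier A" "x \<in> Free" "y \<in> Free"
  shows "prod_op (left_mult a x) y = left_mult a (prod_op x y)"
  by (rule lin_Free_eq[OF lin_comp[OF lin_prod_op_left lin_left_mult] lin_comp[OF lin_left_mult lin_prod_op_left] _ assms(2)])
    (use assms in \<open>simp add: left_mult_left_mult\<close>)

text \<open>Associativity for a left factor da; on symbols it is the Leibniz rule of
  \<open>delta\<close>, solved for \<open>delta a\<close> L(b).\<close>

lemma prod_op_delta:
  assumes "a \<in> carrier A" "x \<in> Free" "y \<in> Free"
  shows "prod_op (delta a x) y = delta a (prod_op x y)"
  by (rule lin_Free_eq[OF lin_comp[OF lin_prod_op_left lin_delta] lin_comp[OF lin_delta lin_prod_op_left] _ assms(2)])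
    (use assms in \<open>simp add: lin_diff[OF lin_prod_op_left] delta_mult\<close>)

lemma iota_delta_list:
  assumes "set as \<subseteq> carrier A" "y \<in> Free"
  shows "iota (delta_list as y) \<approx> prod_op (iota_d as) y + scale ((-1) ^ length as) (delta_list as (iota y))"
  using assms
proof (induction as)
  case Nil
  then show ?case by (simp add: lin_zero[OF lin_prod_op_left])
next
  case (Cons a as)
  have "iota (delta_list (a # as) y) \<approx> left_mult (\<theta> a) (delta_list as y) - delta a (iota (delta_list as y))"
    using Cons by (simp add: iota_delta)
  also have "\<dots> \<approx> left_mult (\<theta> a) (delta_list as y) - delta a (prod_op (iota_d as) y + scale ((-1) ^ length as) (delta_list as (iota y)))"
    using Cons by (intro eqv_diff eqv_delta) auto
  also have "\<dots> = prod_op (iota_d (a # as)) y + scale ((-1) ^ length (a # as)) (delta_list (a # as) (iota y))"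
    using Cons by (simp add: lin_add[OF lin_delta] lin_scale[OF lin_delta] lin_diff[OF lin_prod_op_left] prod_op_delta)
  finally show ?case .
qed

lemma iota_prod_op:
  assumes x: "x \<in> Free_deg i" and y: "y \<in> Free"
  shows "iota (prod_op x y) \<approx> prod_op (iota x) y + scale ((-1) ^ i) (prod_op x (iota y))"
proof (rule lin_Free_deg_eqv[OF lin_comp[OF lin_iota lin_prod_op_left]
      lin_plus[OF lin_comp[OF lin_prod_op_left lin_iota] lin_scaled[OF lin_prod_op_left]] _ x])
  fix a as assume as: "a # as \<in> symbols A i"
  then have c: "a \<in> carrier A" "set as \<subseteq> carrier A" "length as = i" by (auto simp: symbols_def)
  have "iota (left_mult a (delta_list as y)) = left_mult a (iota (delta_list as y))"
    using c y by (simp add: iota_left_mult)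
  also have "\<dots> \<approx> left_mult a (prod_op (iota_d as) y + scale ((-1) ^ i) (delta_list as (iota y)))"
    using iota_delta_list[of as y] c y by (intro eqv_left_mult) auto
  finally show "iota (prod_op (basis (a # as)) y) \<approx> prod_op (iota (basis (a # as))) y + scale ((-1) ^ i) (prod_op (basis (a # as)) (iota y))"
    using c y by (simp add: lin_scale[OF lin_left_mult] lin_add[OF lin_left_mult] prod_op_left_mult)
qed

section \<open>The Cartan formula on homogeneous symbols\<close>

lemma d_op_iota_d:
  assumes "set as \<subseteq> carrier A" "\<And>a. a \<in> set as \<Longrightarrow> \<theta> a = \<omega> a \<odot> a"
  shows "d_op (iota_d as) \<approx> scale (sum_list (map \<omega> as)) (basis (\<one> # as))"
  using assms
proof (induction as)
  case (Cons a as)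
  let ?w = "sum_list (map \<omega> as)"
  have "d_op (iota_d (a # as)) = basis (\<one> # \<theta> a # as) - d_op (delta a (iota_d as))"
    by (simp add: lin_diff[OF lin_d_op])
  \<comment> \<open>Anticommuting \<open>d_op\<close> with \<open>delta a\<close> brings it next to
    \<open>iota_d as\<close>, where the induction hypothesis applies.\<close>
  also have "\<dots> \<approx> basis (\<one> # \<theta> a # as) - (- delta a (d_op (iota_d as)))"
    using Cons by (intro eqv_diff d_op_delta) auto
  also have "\<dots> = basis (\<one> # \<theta> a # as) + delta a (d_op (iota_d as))" by simp
  also have "\<dots> \<approx> scale (\<omega> a) (basis (\<one> # a # as)) + delta a (scale ?w (basis (\<one> # as)))"
  proof (intro eqv_add eqv_delta Cons.IH)
    show "basis (\<one> # \<theta> a # as) \<approx> scale (\<omega> a) (basis (\<one> # a # as))"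
      using Cons relator_smult[of "[\<one>]" as a "\<omega> a"] by simp
  qed (use Cons in auto)
  \<comment> \<open>The other term of \<open>delta a\<close> on \<open>basis (\<one> # as)\<close>
    has \<open>\<one>\<close> in second place and is a relation.\<close>
  also have "\<dots> \<approx> scale (\<omega> a) (basis (\<one> # a # as)) + scale ?w (basis (\<one> # a # as))"
  proof (intro eqv_add eqv_refl)
    have "basis (a # \<one> # as) \<in> Rel"
      using Cons relator_V[of "[a]" as \<one>] one_in_V by simp
    then show "delta a (scale ?w (basis (\<one> # as))) \<approx> scale ?w (basis (\<one> # a # as))"
      using Cons by (simp add: lin_scale[OF lin_delta] eqv_def pm.scale_right_diff_distrib del: scale_single)
  qed
  also have "\<dots> = scale (sum_list (map \<omega> (a # as))) (basis (\<one> # a # as))"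
    by (simp only: pm.scale_left_distrib[symmetric]) simp
  finally show ?case .
qed (simp add: lin_zero[OF lin_d_op])

text \<open>Expanding \<open>delta a\<close> as d L(a) - L(a) d inside the contraction of da cancels
  the first summand d L(a) \<open>iota_d as\<close> and leaves the weight of \<open>a\<close> plus
  L(a) d \<open>iota_d as\<close>.\<close>

lemma cartan:
  assumes "a \<in> carrier A" "set as \<subseteq> carrier A" "\<And>b. b \<in> set (a # as) \<Longrightarrow> \<theta> b = \<omega> b \<odot> b"
  shows "d_op (iota (basis (a # as))) + iota (d_op (basis (a # as)))
    \<approx> scale (sum_list (map \<omega> (a # as))) (basis (a # as))"
proof -
  let ?w = "sum_list (map \<omega> as)"
  have "iota (d_op (basis (a # as))) = iota_d (a # as)"
    using assms by (simp del: iota_d.simps)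
  then have "d_op (iota (basis (a # as))) + iota (d_op (basis (a # as)))
      = basis (\<theta> a # as) + left_mult a (d_op (iota_d as))"
    by (simp add: delta_def)
  also have "\<dots> \<approx> scale (\<omega> a) (basis (a # as)) + left_mult a (scale ?w (basis (\<one> # as)))"
  proof (intro eqv_add eqv_left_mult d_op_iota_d)
    show "basis (\<theta> a # as) \<approx> scale (\<omega> a) (basis (a # as))"
      using assms relator_smult[of "[]" as a "\<omega> a"] by simp
  qed (use assms in auto)
  also have "\<dots> = scale (\<omega> a) (basis (a # as)) + scale ?w (basis (a # as))"
    using assms by (simp add: lin_scale[OF lin_left_mult] del: scale_single)
  also have "\<dots> = scale (sum_list (map \<omega> (a # as))) (basis (a # as))"
    by (simp only: pm.scale_left_distrib[symmetric]) simp
  finally show ?thesis .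
qed

end

section \<open>Supercommutators and weights\<close>

context relative_algebra begin

definition scomm :: "nat \<Rightarrow> nat \<Rightarrow> ('a list \<Rightarrow>\<^sub>0 complex) \<Rightarrow> ('a list \<Rightarrow>\<^sub>0 complex) \<Rightarrow> ('a list \<Rightarrow>\<^sub>0 complex)"
  where "scomm i j x y = prod_op x y - scale ((-1) ^ (i * j)) (prod_op y x)"

text \<open>The relations are included so that membership depends only on the class of a form. They
  come in all degrees, so the supercommutators of degree \<open>n\<close> correspond to the
  intersection with \<open>Free_deg n\<close>.\<close>

definition Comm :: "nat \<Rightarrow> ('a list \<Rightarrow>\<^sub>0 complex) set"
  where "Comm n = pm.span (Rel \<union> {scomm i j x y | i j x y. i + j = n \<and> x \<in> Free_deg i \<and> y \<in> Free_deg j})"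

lemma subspace_Comm [simp]: "pm.subspace (Comm n)"
  by (simp add: Comm_def)

lemmas Comm_closed [simp] = pm.subspace_0[OF subspace_Comm] pm.subspace_add[OF subspace_Comm]
    pm.subspace_diff[OF subspace_Comm] pm.subspace_neg[OF subspace_Comm] pm.subspace_scale[OF subspace_Comm]

lemma Rel_Comm [simp]: "x \<in> Rel \<Longrightarrow> x \<in> Comm n"
  by (auto simp: Comm_def intro: pm.span_base)

lemma scomm_Comm: "x \<in> Free_deg i \<Longrightarrow> y \<in> Free_deg j \<Longrightarrow> i + j = n \<Longrightarrow> scomm i j x y \<in> Comm n"
  by (auto simp: Comm_def intro!: pm.span_base)

lemma eqv_subspace:
  assumes "x \<approx> y" "y \<in> T" "pm.subspace T" "Rel \<subseteq> T"
  shows "x \<in> T"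
  using pm.subspace_add[OF assms(3,2), of "x - y"] assms by (auto simp: eqv_def)

lemma eqv_Comm: "x \<approx> y \<Longrightarrow> y \<in> Comm n \<Longrightarrow> x \<in> Comm n"
  by (rule eqv_subspace) auto

lemma lin_Comm_into:
  assumes "lin f" "pm.subspace T" "\<And>x. x \<in> Rel \<Longrightarrow> f x \<in> T"
    and "\<And>i j x y. i + j = n \<Longrightarrow> x \<in> Free_deg i \<Longrightarrow> y \<in> Free_deg j \<Longrightarrow> f (scomm i j x y) \<in> T"
    and "x \<in> Comm n"
  shows "f x \<in> T"
  by (rule lin_span_into[OF assms(1,2) _ assms(5)[unfolded Comm_def]]) (use assms(3,4) in auto)

text \<open>A superderivation of degree 1 satisfies d [x, y] = [d x, y] + (-1)^i [x, d y] for x of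
  degree i.\<close>

lemma d_op_Comm:
  assumes "x \<in> Comm n"
  shows "d_op x \<in> Comm (Suc n)"
proof (rule lin_Comm_into[OF lin_d_op subspace_Comm _ _ assms])
  fix i j x y
  assume n: "i + j = n" and x: "x \<in> Free_deg i" and y: "y \<in> Free_deg j"
  have "d_op (scomm i j x y) = d_op (prod_op x y) - scale ((-1) ^ (i * j)) (d_op (prod_op y x))"
    by (simp add: scomm_def lin_diff[OF lin_d_op] lin_scale[OF lin_d_op])
  also have "\<dots> \<approx> (prod_op (d_op x) y + scale ((-1) ^ i) (prod_op x (d_op y)))
      - scale ((-1) ^ (i * j)) (prod_op (d_op y) x + scale ((-1) ^ j) (prod_op y (d_op x)))"
    using x y Free_deg_Free by (intro eqv_diff eqv_scale d_op_prod_op) auto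
  also have "\<dots> = scomm (Suc i) j (d_op x) y + scale ((-1) ^ i) (scomm i (Suc j) x (d_op y))"
    by (simp add: scomm_def pm.scale_right_diff_distrib pm.scale_right_distrib power_add algebra_simps
        flip: mult.assoc power_mult_distrib)
  finally show "d_op (scomm i j x y) \<in> Comm (Suc n)"
    by (rule eqv_Comm) (use n x y in \<open>auto intro!: scomm_Comm pm.subspace_scale[OF subspace_Comm] pm.subspace_add[OF subspace_Comm]\<close>)
qed simp

end

section \<open>Contraction and Lie derivative of supercommutators\<close>

context relative_derivation begin

text \<open>As for d, the contraction of a supercommutator is a combination of two supercommutators.
  A factor of degree 0 has contraction zero, which accounts for the cases where a degree would
  become negative.\<close>

lemma iota_Comm:
  assumes "x \<in> Comm n"
  shows "iota x \<in> Comm (n - 1)"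
proof (rule lin_Comm_into[OF lin_iota subspace_Comm _ _ assms])
  fix i j x y
  assume n: "i + j = n" and x: "x \<in> Free_deg i" and y: "y \<in> Free_deg j"
  have "iota (scomm i j x y) = iota (prod_op x y) - scale ((-1) ^ (i * j)) (iota (prod_op y x))"
    by (simp add: scomm_def lin_diff[OF lin_iota] lin_scale[OF lin_iota])
  also have "\<dots> \<approx> (prod_op (iota x) y + scale ((-1) ^ i) (prod_op x (iota y)))
      - scale ((-1) ^ (i * j)) (prod_op (iota y) x + scale ((-1) ^ j) (prod_op y (iota x)))"
    using x y Free_deg_Free by (intro eqv_diff eqv_scale iota_prod_op) auto
  also have "\<dots> = (prod_op (iota x) y - scale ((-1) ^ (i * j) * (-1) ^ j) (prod_op y (iota x)))
      + scale ((-1) ^ i) (prod_op x (iota y) - scale ((-1) ^ (i * j) * (-1) ^ i) (prod_op (iota y) x))"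
    by (simp add: pm.scale_right_diff_distrib pm.scale_right_distrib algebra_simps
        flip: mult.assoc power_mult_distrib)
  finally have eq: "iota (scomm i j x y) \<approx> \<dots>" .
  have "prod_op (iota x) y - scale ((-1) ^ (i * j) * (-1) ^ j) (prod_op y (iota x)) \<in> Comm (n - 1)"
  proof (cases i)
    case 0
    then show ?thesis using x iota_Free_deg_0[of x] by (simp add: lin_zero[OF lin_prod_op_left] lin_zero[OF lin_prod_op_right])
  next
    case (Suc i')
    then have "prod_op (iota x) y - scale ((-1) ^ (i * j) * (-1) ^ j) (prod_op y (iota x)) = scomm i' j (iota x) y"
      by (simp add: scomm_def power_add flip: power_mult_distrib)
    then show ?thesis using Suc n x y iota_Free_deg[of x i] by (auto intro: scomm_Comm)
  qed
  moreover have "prod_op x (iota y) - scale ((-1) ^ (i * j) * (-1) ^ i) (prod_op (iota y) x) \<in> Comm (n - 1)"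
  proof (cases j)
    case 0
    then show ?thesis using y iota_Free_deg_0[of y] by (simp add: lin_zero[OF lin_prod_op_left] lin_zero[OF lin_prod_op_right])
  next
    case (Suc j')
    then have "prod_op x (iota y) - scale ((-1) ^ (i * j) * (-1) ^ i) (prod_op (iota y) x) = scomm i j' x (iota y)"
      by (simp add: scomm_def power_add flip: power_mult_distrib)
    then show ?thesis using Suc n x y iota_Free_deg[of y j] by (auto intro: scomm_Comm)
  qed
  ultimately show "iota (scomm i j x y) \<in> Comm (n - 1)"
    using eq by (auto intro: eqv_Comm)
qed simp

text \<open>The Lie derivative along \<theta>, taken in Cartan's form so that its compatibility with
  relations and supercommutators is inherited from \<open>d_op\<close> and
  \<open>iota\<close>.\<close>

definition Lie :: "('a list \<Rightarrow>\<^sub>0 complex) \<Rightarrow> ('a list \<Rightarrow>\<^sub>0 complex)"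
  where "Lie x = d_op (iota x) + iota (d_op x)"

lemma lin_Lie: "lin Lie"
  unfolding Lie_def[abs_def]
  by (intro lin_plus lin_comp[OF lin_d_op lin_iota] lin_comp[OF lin_iota lin_d_op])

lemma Lie_Rel: "x \<in> Rel \<Longrightarrow> Lie x \<in> Rel"
  by (simp add: Lie_def)

text \<open>In degree 0 truncated subtraction makes \<open>iota_Comm\<close> too weak for
  \<open>Lie_Comm\<close>: applying d afterwards would land in degree 1. The contraction of a
  commutator of degree 0 is in fact zero.\<close>

lemma iota_Comm_0:
  assumes "x \<in> Comm 0"
  shows "iota x \<in> Rel"
proof (rule lin_Comm_into[OF lin_iota subspace_Rel _ _ assms])
  fix i j :: nat and x y
  assume "i + j = 0" "x \<in> Free_deg i" "y \<in> Free_deg j"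
  then have "scomm i j x y \<in> Free_deg 0"
    using prod_op_Free_deg[of x 0 y 0] prod_op_Free_deg[of y 0 x 0] by (simp add: scomm_def)
  then show "iota (scomm i j x y) \<in> Rel" by (simp add: iota_Free_deg_0)
qed simp

lemma Lie_Comm: "x \<in> Comm n \<Longrightarrow> Lie x \<in> Comm n"
  using d_op_Comm[OF iota_Comm[of x n]] iota_Comm[OF d_op_Comm[of x n]] iota_Comm_0[of x]
  by (cases n) (auto simp: Lie_def)

end

text \<open>
  \<open>B\<close> consists of homogeneous elements, of weight \<open>wt\<close>; the assumption \<open>B_span\<close> says that it spans \<open>A\<close>.
\<close>

locale euler_derivation = relative_derivation +
  fixes B :: "'a set" and wt :: "'a \<Rightarrow> nat"
  assumes B_carrier: "B \<subseteq> carrier A"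
    and theta_B: "b \<in> B \<Longrightarrow> \<theta> b = of_nat (wt b) \<odot> b"
    and wt_0: "b \<in> B \<Longrightarrow> wt b = 0 \<Longrightarrow> b \<in> V"
    and B_span: "a \<in> carrier A \<Longrightarrow> Pr \<zero> \<Longrightarrow> (\<And>b. b \<in> B \<Longrightarrow> Pr b) \<Longrightarrow>
      (\<And>a b. a \<in> carrier A \<Longrightarrow> b \<in> carrier A \<Longrightarrow> Pr a \<Longrightarrow> Pr b \<Longrightarrow> Pr (a \<oplus> b)) \<Longrightarrow>
      (\<And>c a. a \<in> carrier A \<Longrightarrow> Pr a \<Longrightarrow> Pr (c \<odot> a)) \<Longrightarrow> Pr a"
    and V_add: "u \<in> V \<Longrightarrow> v \<in> V \<Longrightarrow> u \<oplus> v \<in> V"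
    and V_smult: "v \<in> V \<Longrightarrow> c \<odot> v \<in> V"
    and traces_separate: "v \<in> V \<Longrightarrow> v \<noteq> \<zero> \<Longrightarrow> \<exists>\<chi> :: 'a \<Rightarrow> complex. \<chi> v \<noteq> 0 \<and>
      (\<forall>a\<in>carrier A. \<forall>b\<in>carrier A. \<chi> (a \<oplus> b) = \<chi> a + \<chi> b \<and> \<chi> (a \<otimes> b) = \<chi> (b \<otimes> a)) \<and>
      (\<forall>c. \<forall>a\<in>carrier A. \<chi> (c \<odot> a) = c * \<chi> a)"
begin

text \<open>The predicate \<open>W\<close> on total weights lets one definition cover all weights,
  weight 0, and the weights from 1 to a bound.\<close>

definition Homog :: "nat \<Rightarrow> (nat \<Rightarrow> bool) \<Rightarrow> ('a list \<Rightarrow>\<^sub>0 complex) set"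
  where "Homog n W = pm.span (basis ` {as. length as = Suc n \<and> set as \<subseteq> B \<and> W (sum_list (map wt as))})"

lemma subspace_Homog [simp]: "pm.subspace (Homog n W)"
  by (simp add: Homog_def)

text \<open>Multilinearity, one entry at a time from the left: \<open>xs\<close> holds the entries
  already expanded in \<open>B\<close>, \<open>ys\<close> those still arbitrary.\<close>

lemma basis_homogeneous:
  assumes "set xs \<subseteq> B" "set ys \<subseteq> carrier A" "length xs + length ys = Suc n"
  shows "basis (xs @ ys) \<in> pm.span (Rel \<union> Homog n (\<lambda>_. True))"
  using assms
proof (induction ys arbitrary: xs)
  case Nil
  then show ?case
    by (auto simp: Homog_def intro!: pm.span_base)
next
  case (Cons a ys)
  let ?T = "pm.span (Rel \<union> Homog n (\<lambda>_. True))"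
  have xs: "set xs \<subseteq> carrier A" and ys: "set ys \<subseteq> carrier A" and a: "a \<in> carrier A"
    using Cons.prems B_carrier by auto
  have RT: "Rel \<subseteq> ?T" using pm.span_superset by blast
  from a show ?case
  proof (rule B_span[of a "\<lambda>a. basis (xs @ a # ys) \<in> ?T"])
    show "basis (xs @ \<zero> # ys) \<in> ?T"
      using relator_zero[OF xs ys] RT by auto
  next
    fix b assume "b \<in> B"
    then show "basis (xs @ b # ys) \<in> ?T"
      using Cons.IH[of "xs @ [b]"] Cons.prems by auto
  next
    fix a b assume "a \<in> carrier A" "b \<in> carrier A" "basis (xs @ a # ys) \<in> ?T" "basis (xs @ b # ys) \<in> ?T"
    then show "basis (xs @ (a \<oplus> b) # ys) \<in> ?T"
      using eqv_subspace[OF relator_add[OF xs ys]] RT by (simp add: pm.span_add)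
  next
    fix c a assume "a \<in> carrier A" "basis (xs @ a # ys) \<in> ?T"
    then show "basis (xs @ (c \<odot> a) # ys) \<in> ?T"
      by (intro eqv_subspace[OF relator_smult[OF xs ys] _ pm.subspace_span RT] pm.span_scale)
  qed
qed

lemma Homog_split:
  assumes "x \<in> Homog n (\<lambda>_. True)"
  shows "\<exists>x0 xp N. x = x0 + xp \<and> x0 \<in> Homog n (\<lambda>w. w = 0) \<and> xp \<in> Homog n (\<lambda>w. 1 \<le> w \<and> w \<le> N)"
  using assms unfolding Homog_def[of n "\<lambda>_. True"]
proof (induction rule: pm.span_induct_alt)
  case base
  show ?case
    by (intro exI[of _ 0] conjI pm.subspace_0 subspace_Homog) simp
next
  case (step c y x)
  then obtain x0 xp N where x: "x = x0 + xp" "x0 \<in> Homog n (\<lambda>w. w = 0)" "xp \<in> Homog n (\<lambda>w. 1 \<le> w \<and> w \<le> N)"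
    by auto
  obtain as where y: "y = basis as" "length as = Suc n" "set as \<subseteq> B"
    using step by auto
  show ?case
  proof (cases "sum_list (map wt as) = 0")
    case True
    then have "y \<in> Homog n (\<lambda>w. w = 0)"
      using y unfolding Homog_def by (intro pm.span_base) blast
    then have "scale c y + x0 \<in> Homog n (\<lambda>w. w = 0)"
      using x by (intro pm.subspace_add pm.subspace_scale subspace_Homog)
    then show ?thesis
      using x by (intro exI[of _ "scale c y + x0"] exI[of _ xp] exI[of _ N]) auto
  next
    case False
    \<comment> \<open>The sum bounds both the earlier weights and the new one; a finite combination
      needs only finitely many such enlargements.\<close>
    define N' where "N' = N + sum_list (map wt as)"
    have "y \<in> Homog n (\<lambda>w. 1 \<le> w \<and> w \<le> N')"
      unfolding Homog_def N'_def y(1)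
      by (intro pm.span_base imageI) (use y(2,3) False in \<open>simp add: Suc_le_eq del: sum_list_eq_0_iff\<close>)
    moreover have "xp \<in> Homog n (\<lambda>w. 1 \<le> w \<and> w \<le> N')"
      using x(3) unfolding Homog_def N'_def by (rule subsetD[OF pm.span_mono, rotated]) auto
    ultimately have "scale c y + xp \<in> Homog n (\<lambda>w. 1 \<le> w \<and> w \<le> N')"
      by (intro pm.subspace_add pm.subspace_scale subspace_Homog)
    then show ?thesis
      using x by (intro exI[of _ x0] exI[of _ "scale c y + xp"] exI[of _ N']) auto
  qed
qed

lemma homogeneous_decomposition:
  assumes "x \<in> Free_deg n"
  shows "\<exists>x0 xp N. x \<approx> x0 + xp \<and> x0 \<in> Homog n (\<lambda>w. w = 0) \<and> xp \<in> Homog n (\<lambda>w. 1 \<le> w \<and> w \<le> N)"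
proof -
  have "x \<in> pm.span (Rel \<union> Homog n (\<lambda>_. True))"
    by (rule lin_Free_deg_into[OF lin_ident pm.subspace_span _ assms])
      (use basis_homogeneous[of "[]"] in \<open>auto simp: symbols_def\<close>)
  then obtain r h where x: "x = r + h" "r \<in> Rel" "h \<in> Homog n (\<lambda>_. True)"
    unfolding pm.span_Un by (auto simp: pm.span_eq_iff[THEN iffD2])
  then have "x \<approx> h" by (simp add: eqv_def)
  then show ?thesis using Homog_split[OF x(3)] by auto
qed

lemma Lie_basis:
  assumes "as \<noteq> []" "set as \<subseteq> B"
  shows "Lie (basis as) \<approx> scale (of_nat (sum_list (map wt as))) (basis as)"
proof -
  obtain a as' where as: "as = a # as'" using assms by (cases as) auto
  have *: "sum_list (map (\<lambda>b. of_nat (wt b)) bs) = (of_nat (sum_list (map wt bs)) :: complex)" for bs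
    by (induction bs) auto
  show ?thesis
    unfolding as Lie_def *[symmetric]
    by (rule cartan) (use as assms B_carrier theta_B in auto)
qed

lemma Lie_Homog_0: "x \<in> Homog n (\<lambda>w. w = 0) \<Longrightarrow> Lie x \<in> Rel"
  unfolding Homog_def
proof (erule lin_span_into[OF lin_Lie subspace_Rel, rotated])
  fix s assume "s \<in> basis ` {as. length as = Suc n \<and> set as \<subseteq> B \<and> sum_list (map wt as) = 0}"
  then obtain as where "s = basis as" "length as = Suc n" "set as \<subseteq> B" "sum_list (map wt as) = 0"
    by auto
  moreover from this have "Lie s \<approx> scale (of_nat (sum_list (map wt as))) s"
    using Lie_basis[of as] by fastforce
  ultimately show "Lie s \<in> Rel"
    by (simp add: eqv_def del: sum_list_eq_0_iff scale_single)
qed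

text \<open>Total weight 0 puts every entry into \<open>V\<close>, and in positive degree there is
  an entry behind the first.\<close>

lemma Homog_0_pos:
  assumes "x \<in> Homog (Suc n) (\<lambda>w. w = 0)"
  shows "x \<in> Rel"
proof (rule lin_span_into[OF lin_ident subspace_Rel _ assms[unfolded Homog_def]])
  fix s assume "s \<in> basis ` {as. length as = Suc (Suc n) \<and> set as \<subseteq> B \<and> sum_list (map wt as) = 0}"
  then obtain a b as where s: "s = basis (a # b # as)" and B: "a \<in> B" "b \<in> B" "set as \<subseteq> B" and "wt b = 0"
    by (auto simp: length_Suc_conv)
  then show "s \<in> Rel"
    using relator_V[of "[a]" as b] wt_0[of b] B_carrier by auto
qed

text \<open>
  Since \<open>Lie\<close> acts on weight \<open>w\<close> as multiplication by \<open>w\<close>, the operator \<open>Lie - N\<close> kills the top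
  weight \<open>N\<close>; this lowers the number of weights without assuming that \<open>T\<close> is graded.
\<close>

lemma Homog_pos_mem:
  assumes T: "pm.subspace T" "Rel \<subseteq> T" "\<And>y. y \<in> T \<Longrightarrow> Lie y \<in> T"
    and "x \<in> Homog n (\<lambda>w. 1 \<le> w \<and> w \<le> N)" and "Lie x \<in> T"
  shows "x \<in> T"
  using assms(4,5)
proof (induction N arbitrary: x)
  case 0
  have *: "(\<lambda>w. 1 \<le> w \<and> w \<le> (0::nat)) = (\<lambda>w. False)" by auto
  have "Homog n (\<lambda>w. 1 \<le> w \<and> w \<le> 0) = {0}"
    unfolding * Homog_def by simp
  then show ?case
    using 0 pm.subspace_0[OF T(1)] by simp
next
  case (Suc N)
  let ?f = "\<lambda>x. Lie x - scale (of_nat (Suc N)) x"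
  have f: "lin ?f"
    by (intro lin_minus lin_Lie lin_scaled lin_ident)
  have "?f x \<in> pm.span (Rel \<union> Homog n (\<lambda>w. 1 \<le> w \<and> w \<le> N))"
  proof (rule lin_span_into[OF f pm.subspace_span _ Suc.prems(1)[unfolded Homog_def]])
    fix s assume "s \<in> basis ` {as. length as = Suc n \<and> set as \<subseteq> B \<and> 1 \<le> sum_list (map wt as) \<and> sum_list (map wt as) \<le> Suc N}"
    then obtain as where s: "s = basis as" "length as = Suc n" "set as \<subseteq> B"
        "1 \<le> sum_list (map wt as)" "sum_list (map wt as) \<le> Suc N"
      by auto
    let ?w = "sum_list (map wt as)"
    have "Lie s \<approx> scale (of_nat ?w) s"
      using s Lie_basis[of as] by fastforce
    then have *: "?f s \<approx> scale (of_nat ?w - of_nat (Suc N)) s"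
      unfolding pm.scale_left_diff_distrib by (intro eqv_diff eqv_refl)
    show "?f s \<in> pm.span (Rel \<union> Homog n (\<lambda>w. 1 \<le> w \<and> w \<le> N))"
    proof (rule eqv_subspace[OF * _ pm.subspace_span])
      show "scale (of_nat ?w - of_nat (Suc N)) s \<in> pm.span (Rel \<union> Homog n (\<lambda>w. 1 \<le> w \<and> w \<le> N))"
      proof (cases "?w = Suc N")
        case True
        then show ?thesis by (simp only: True diff_self pm.scale_zero_left pm.span_zero)
      next
        case False
        then have "s \<in> Homog n (\<lambda>w. 1 \<le> w \<and> w \<le> N)"
          using s unfolding Homog_def by (intro pm.span_base) auto
        then show ?thesis by (intro pm.span_scale pm.span_base) auto
      qed
    qed (use pm.span_superset in blast)
  qed
  then obtain r y where y: "?f x = r + y" "r \<in> Rel" "y \<in> Homog n (\<lambda>w. 1 \<le> w \<and> w \<le> N)"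
    unfolding pm.span_Un by (auto simp: pm.span_eq_iff[THEN iffD2])
  \<comment> \<open>Both \<open>Lie (Lie x)\<close> and \<open>Lie x\<close> lie in
    \<open>T\<close>. Up to a relation \<open>?f x\<close> is \<open>y\<close>, which has one weight
    fewer, so this supplies the hypothesis for \<open>y\<close>.\<close>
  have "Lie (?f x) \<in> T"
    using T(3)[OF Suc.prems(2)] Suc.prems(2)
    by (simp add: lin_diff[OF lin_Lie] lin_scale[OF lin_Lie] pm.subspace_diff[OF T(1)] pm.subspace_scale[OF T(1)]
        del: of_nat_Suc)
  then have "Lie r + Lie y \<in> T"
    unfolding y lin_add[OF lin_Lie] .
  moreover have "Lie r \<in> T"
    using Lie_Rel[OF y(2)] T(2) by auto
  ultimately have "Lie y \<in> T"
    using pm.subspace_diff[OF T(1), of "Lie r + Lie y" "Lie r"] by simp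
  then have "y \<in> T" by (rule Suc.IH[OF y(3)])
  then have "?f x \<in> T"
    unfolding y using y(2) T(2) by (intro pm.subspace_add[OF T(1)]) auto
  \<comment> \<open>\<open>Lie x\<close> minus \<open>?f x\<close> is \<open>x\<close> times
    \<open>Suc N\<close>, a nonzero scalar.\<close>
  then have "scale (inverse (of_nat (Suc N))) (Lie x - ?f x) \<in> T"
    by (rule pm.subspace_scale[OF T(1) pm.subspace_diff[OF T(1) Suc.prems(2)]])
  then show ?case
    by (simp del: of_nat_Suc)
qed

text \<open>Take \<open>T\<close> to be exact forms plus supercommutators. It is stable under
  \<open>Lie\<close>, and for closed \<open>x\<close> it contains \<open>Lie x\<close>, the sum of
  the exact d \<iota> x and the supercommutator part \<iota> d x. So it contains the part of
  \<open>x\<close> of positive weight, while the part of weight 0 is a relation.\<close>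

lemma exact_pos:
  assumes x: "x \<in> Free_deg (Suc m)" and dx: "d_op x \<in> Comm (Suc (Suc m))"
  shows "\<exists>y\<in>Free_deg m. x - d_op y \<in> Comm (Suc m)"
proof -
  define T where "T = {d_op y + s | y s. y \<in> Free_deg m \<and> s \<in> Comm (Suc m)}"
  have TI: "d_op y + s \<in> T" if "y \<in> Free_deg m" "s \<in> Comm (Suc m)" for y s
    using that by (auto simp: T_def)
  have ST: "s \<in> T" if "s \<in> Comm (Suc m)" for s
    using TI[of 0 s] that by (simp add: lin_zero[OF lin_d_op])
  have T: "pm.subspace T"
  proof (rule pm.subspaceI)
    show "0 \<in> T" by (rule ST) simp
    show "u + w \<in> T" if u: "u \<in> T" and w: "w \<in> T" for u w
    proof -
      obtain y s where "u = d_op y + s" "y \<in> Free_deg m" "s \<in> Comm (Suc m)" using u by (auto simp: T_def)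
      moreover obtain y' s' where "w = d_op y' + s'" "y' \<in> Free_deg m" "s' \<in> Comm (Suc m)" using w by (auto simp: T_def)
      ultimately show ?thesis
        using TI[of "y + y'" "s + s'"] by (simp add: lin_add[OF lin_d_op] algebra_simps)
    qed
    show "scale c u \<in> T" if u: "u \<in> T" for c u
    proof -
      obtain y s where "u = d_op y + s" "y \<in> Free_deg m" "s \<in> Comm (Suc m)" using u by (auto simp: T_def)
      then show ?thesis
        using TI[of "scale c y" "scale c s"] by (simp add: lin_scale[OF lin_d_op] pm.scale_right_distrib)
    qed
  qed
  have RT: "Rel \<subseteq> T" using ST by auto
  have LT: "Lie u \<in> T" if u: "u \<in> T" for u
  proof -
    obtain y s where u: "u = d_op y + s" "y \<in> Free_deg m" "s \<in> Comm (Suc m)" using u by (auto simp: T_def)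
    have "Lie u = d_op (iota (d_op y)) + (iota (d_op (d_op y)) + Lie s)"
      unfolding u lin_add[OF lin_Lie] by (simp add: Lie_def)
    also have "\<dots> \<in> T"
      using iota_Free_deg[OF d_op_Free_deg[OF u(2)]] d_op_d_op[OF Free_deg_Free[OF u(2)]] Lie_Comm[OF u(3)]
      by (intro TI) (auto intro!: pm.subspace_add[OF subspace_Comm])
    finally show ?thesis .
  qed
  have Lx: "Lie x \<in> T"
    unfolding Lie_def using iota_Free_deg[OF x] iota_Comm[OF dx] by (intro TI) auto
  obtain x0 xp N where dec: "x \<approx> x0 + xp" "x0 \<in> Homog (Suc m) (\<lambda>w. w = 0)"
      "xp \<in> Homog (Suc m) (\<lambda>w. 1 \<le> w \<and> w \<le> N)"
    using homogeneous_decomposition[OF x] by auto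
  have "x0 + xp \<approx> xp"
    using Homog_0_pos[OF dec(2)] by (simp add: eqv_def)
  with dec(1) have xp: "x \<approx> xp" by (rule eqv_trans)
  have "Lie xp \<approx> Lie x"
    by (rule eqv_lin[OF lin_Lie Lie_Rel eqv_sym[OF xp]])
  then have "Lie xp \<in> T" by (rule eqv_subspace[OF _ Lx T RT])
  then have "xp \<in> T" using Homog_pos_mem[OF T RT _ dec(3)] LT by blast
  then have "x \<in> T" by (rule eqv_subspace[OF xp _ T RT])
  then obtain y s where "x = d_op y + s" "y \<in> Free_deg m" "s \<in> Comm (Suc m)" by (auto simp: T_def)
  then show ?thesis by (intro bexI[of _ y]) auto
qed

text \<open>Linearity in the single entry collapses a combination of symbols of degree 0 into one
  symbol.\<close>

lemma Homog_0_V: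
  assumes "x \<in> Homog 0 (\<lambda>w. w = 0)"
  shows "\<exists>v\<in>V. x \<approx> basis [v]"
  using assms unfolding Homog_def
proof (induction rule: pm.span_induct_alt)
  case base
  have "\<zero> \<in> V" using V_smult[OF one_in_V, of 0] by (simp add: zero_smult)
  moreover have "0 \<approx> basis [\<zero>]" using relator_zero[of "[]" "[]"] by (simp add: eqv_def)
  ultimately show ?case by auto
next
  case (step c y x)
  then obtain b where b: "y = basis [b]" "b \<in> B" "wt b = 0"
    by (auto simp: length_Suc_conv)
  obtain v where v: "v \<in> V" "x \<approx> basis [v]" using step by auto
  have bV: "b \<in> V" using wt_0 b by auto
  have "scale c y + x \<approx> basis [c \<odot> b] + basis [v]"
    unfolding b(1) using relator_smult[of "[]" "[]" b c] bV
    by (intro eqv_add v(2) eqv_sym[of "basis [c \<odot> b]"]) simp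
  also have "\<dots> \<approx> basis [c \<odot> b \<oplus> v]"
    using eqv_sym[OF relator_add[of "[]" "[]" "c \<odot> b" v]] bV v(1) by simp
  finally show ?case
    using V_add[OF V_smult[OF bV] v(1)] by blast
qed

text \<open>In degree 0 the contraction of \<open>x\<close> vanishes, so \<open>Lie x\<close> is
  \<iota> d x and lies in \<open>Comm 0\<close>. With \<open>Comm 0\<close> in the role of
  \<open>T\<close> the positive weights disappear, and weight 0 supplies \<open>v\<close>.\<close>

lemma exact_0:
  assumes x: "x \<in> Free_deg 0" and dx: "d_op x \<in> Comm 1"
  shows "\<exists>v\<in>V. x - basis [v] \<in> Comm 0"
proof -
  obtain x0 xp N where dec: "x \<approx> x0 + xp" "x0 \<in> Homog 0 (\<lambda>w. w = 0)"
      "xp \<in> Homog 0 (\<lambda>w. 1 \<le> w \<and> w \<le> N)"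
    using homogeneous_decomposition[OF x] by auto
  have "Lie x \<in> Comm 0"
    using iota_Comm[OF dx] by (simp add: Lie_def iota_Free_deg_0[OF x] lin_zero[OF lin_d_op])
  moreover have "Lie xp \<approx> Lie x"
  proof -
    have "Lie x \<approx> Lie (x0 + xp)" by (rule eqv_lin[OF lin_Lie Lie_Rel dec(1)])
    also have "Lie (x0 + xp) \<approx> Lie xp"
      using Lie_Homog_0[OF dec(2)] by (simp add: eqv_def lin_add[OF lin_Lie])
    finally show ?thesis by (rule eqv_sym)
  qed
  ultimately have "Lie xp \<in> Comm 0" by (auto intro: eqv_Comm)
  then have xp: "xp \<in> Comm 0"
    by (intro Homog_pos_mem[OF subspace_Comm _ _ dec(3)]) (auto intro: Lie_Comm)
  obtain v where v: "v \<in> V" "x0 \<approx> basis [v]" using Homog_0_V[OF dec(2)] by auto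
  have "x - basis [v] \<approx> (x0 + xp) - x0"
    by (intro eqv_diff dec(1) eqv_sym[OF v(2)])
  then show ?thesis
    using xp v(1) by (auto intro: eqv_Comm)
qed

text \<open>A trace kills commutators and respects the relations in degree 0, so \<open>v\<close>
  cannot be a combination of them if some trace is nonzero on it.\<close>

lemma V_inter_Comm_0:
  assumes v: "v \<in> V" and "basis [v] \<in> Comm 0"
  shows "v = \<zero>"
proof (rule ccontr)
  assume "v \<noteq> \<zero>"
  then obtain \<chi> :: "'a \<Rightarrow> complex" where \<chi>: "\<chi> v \<noteq> 0"
      "\<And>a b. a \<in> carrier A \<Longrightarrow> b \<in> carrier A \<Longrightarrow> \<chi> (a \<oplus> b) = \<chi> a + \<chi> b"
      "\<And>a b. a \<in> carrier A \<Longrightarrow> b \<in> carrier A \<Longrightarrow> \<chi> (a \<otimes> b) = \<chi> (b \<otimes> a)"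
      "\<And>c a. a \<in> carrier A \<Longrightarrow> \<chi> (c \<odot> a) = c * \<chi> a"
    using traces_separate[OF v] by blast
  \<comment> \<open>The trace \<chi>, extended by zero to symbols of positive degree. The values lie
    in a one-dimensional free space so that the reduction to generators applies. Balancing and
    vanishing relators have at least two entries and go to zero at once.\<close>
  define f :: "('a list \<Rightarrow>\<^sub>0 complex) \<Rightarrow> (unit \<Rightarrow>\<^sub>0 complex)"
    where "f = lin_ext (\<lambda>as. if length as = 1 then Poly_Mapping.single () (\<chi> (hd as)) else 0)"
  have f: "lin f" unfolding f_def by (rule lin_lin_ext)
  have fR: "f x \<in> {0}" if "x \<in> Rel" for x
  proof (rule lin_Rel_into[OF f pm.subspace_single_0 that], goal_cases)
    case (1 xs a b ys)
    then show ?case by (cases xs; cases ys) (auto simp: f_def \<chi> single_add)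
  next
    case (2 xs c a ys)
    then show ?case by (cases xs; cases ys) (auto simp: f_def \<chi>)
  qed (auto simp: f_def)
  have fP: "f (prod_op x y) = f (prod_op y x)" if x: "x \<in> Free_deg 0" and y: "y \<in> Free_deg 0" for x y
  proof -
    have "f (prod_op x y) - f (prod_op y x) \<in> {0}"
    proof (rule lin_Free_deg_into[OF lin_minus[OF lin_comp[OF f lin_prod_op_left] lin_comp[OF f lin_prod_op_right]] pm.subspace_single_0 _ x])
      fix as assume as: "as \<in> symbols A 0"
      show "f (prod_op (basis as) y) - f (prod_op y (basis as)) \<in> {0}"
      proof (rule lin_Free_deg_into[OF lin_minus[OF lin_comp[OF f lin_prod_op_right] lin_comp[OF f lin_prod_op_left]] pm.subspace_single_0 _ y])
        fix bs assume "bs \<in> symbols A 0"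
        then show "f (prod_op (basis as) (basis bs)) - f (prod_op (basis bs) (basis as)) \<in> {0}"
          using as by (auto simp: symbols_def length_Suc_conv f_def \<chi>)
      qed
    qed
    then show ?thesis by simp
  qed
  have "f (basis [v]) \<in> {0}"
  proof (rule lin_Comm_into[OF f pm.subspace_single_0 fR _ assms(2)])
    fix i j :: nat and x y
    assume "i + j = 0" "x \<in> Free_deg i" "y \<in> Free_deg j"
    then show "f (scomm i j x y) \<in> {0}"
      using fP[of x y] by (simp add: scomm_def lin_diff[OF f])
  qed
  then show False
    using \<chi>(1) lookup_single_eq[of "()" "\<chi> v"] by (simp add: f_def)
qed

end

section \<open>The Karoubi complex on representatives\<close>

lemma module_free_module: "module complex_field (free_module S)"
proof (rule moduleI)
  show "cring (complex_field :: complex ring)" by (rule cring_from_type_algebra)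
  show "abelian_group (free_module S)"
  proof (rule abelian_groupI)
    fix f assume "f \<in> carrier (free_module S)"
    then show "\<exists>g\<in>carrier (free_module S). g \<oplus>\<^bsub>free_module S\<^esub> f = \<zero>\<^bsub>free_module S\<^esub>"
      by (intro bexI[of _ "- f"]) (auto simp: free_module_def in_keys_iff)
  qed (use keys_add in \<open>fastforce simp: free_module_def algebra_simps\<close>)+
qed (auto simp: free_module_def ring_of_type_algebra_def in_keys_iff pm.scale_left_distrib pm.scale_right_distrib)

lemma free_module_simps [simp]:
  "\<zero>\<^bsub>free_module S\<^esub> = 0" "f \<oplus>\<^bsub>free_module S\<^esub> g = f + g" "c \<odot>\<^bsub>free_module S\<^esub> f = scale c f"
  by (simp_all add: free_module_def)

lemma carrier_free_module: "carrier (free_module S) = pm.span (basis ` S)"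
  by (simp add: free_module_def free_eq_span)

lemma minus_free_module [simp]:
  assumes "f \<in> carrier (free_module S)" "g \<in> carrier (free_module S)"
  shows "f \<ominus>\<^bsub>free_module S\<^esub> g = f - g"
proof -
  interpret module complex_field "free_module S" by (rule module_free_module)
  have "\<ominus>\<^bsub>free_module S\<^esub> g = - g"
    by (rule M.minus_equality) (use assms in \<open>auto simp: carrier_free_module pm.span_neg\<close>)
  then show ?thesis by (simp add: a_minus_def)
qed

lemma submodule_free_module:
  assumes "H \<subseteq> carrier (free_module S)" and H: "pm.subspace H"
  shows "submodule H complex_field (free_module S)"
proof -
  interpret module complex_field "free_module S" by (rule module_free_module)
  show ?thesis
  proof (rule submoduleI)
    fix f assume f: "f \<in> H"
    have "\<ominus>\<^bsub>free_module S\<^esub> f = - f"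
      by (rule M.minus_equality) (use assms(1) f in \<open>auto simp: carrier_free_module intro: pm.span_neg\<close>)
    then show "\<ominus>\<^bsub>free_module S\<^esub> f \<in> H" using pm.subspace_neg[OF H f] by simp
  qed (use assms pm.subspace_0[OF H] pm.subspace_add[OF H] pm.subspace_scale[OF H] in auto)
qed

lemma subspace_submodule_free_module:
  assumes "submodule H complex_field (free_module S)"
  shows "pm.subspace H"
  using module.submoduleE[OF module_free_module assms] submodule.smult_closed[OF assms]
    subgroup.one_closed[OF submodule.axioms(1)[OF assms]]
  by (intro pm.subspaceI) auto

text \<open>Submodules of the record are exactly the subspaces inside its carrier, so the two hulls
  agree.\<close>

lemma module_span_free_module:
  assumes "X' \<subseteq> carrier (free_module S)"
  shows "module_span complex_field (free_module S) X' = pm.span X'"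
  unfolding module_span_def
proof (rule hull_unique)
  show "X' \<subseteq> pm.span X'" by (rule pm.span_superset)
  show "submodule (pm.span X') complex_field (free_module S)"
    using assms unfolding carrier_free_module
    by (intro submodule_free_module) (simp_all add: carrier_free_module pm.span_minimal)
  show "pm.span X' \<subseteq> t" if "X' \<subseteq> t" "submodule t complex_field (free_module S)" for t
    using that by (intro pm.span_minimal subspace_submodule_free_module)
qed

section \<open>Classes of forms and of Karoubi forms\<close>

context relative_algebra begin

lemma carrier_free_forms [simp]: "carrier (free_forms A n) = Free_deg n"
  by (simp add: carrier_free_module Free_deg_def)

lemma form_relators_Free_deg: "r \<in> form_relators A V n \<Longrightarrow> r \<in> Free_deg n"
proof -
  assume "r \<in> form_relators A V n"
  then consider (1) xs a b ys where "r = basis (xs @ (a \<oplus> b) # ys) - basis (xs @ a # ys) - basis (xs @ b # ys)"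
      "xs @ a # ys \<in> symbols A n" "b \<in> carrier A"
    | (2) xs c a ys where "r = basis (xs @ (c \<odot> a) # ys) - scale c (basis (xs @ a # ys))"
      "xs @ a # ys \<in> symbols A n"
    | (3) xs a v b ys where "r = basis (xs @ (a \<otimes> v) # b # ys) - basis (xs @ a # (v \<otimes> b) # ys)"
      "xs @ a # b # ys \<in> symbols A n" "v \<in> V"
    | (4) xs v ys where "r = basis (xs @ v # ys)" "xs @ v # ys \<in> symbols A n" "xs \<noteq> []" "v \<in> V"
    unfolding form_relators_def Un_iff mem_Collect_eq
    by (elim disjE exE conjE) (rule that; assumption)+
  then show "r \<in> Free_deg n"
    by cases (auto intro!: Free_deg_closed basis_Free_deg simp: symbols_def simp del: scale_single)
qed

text \<open>\<open>Rel\<close> mixes degrees, but each relator has only one. The projection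
  \<open>pr\<close> onto symbols of degree \<open>n\<close> therefore maps a relator to itself or to
  zero, and it fixes \<open>Free_deg n\<close>.\<close>

lemma form_relations_eq: "form_relations A V n = Free_deg n \<inter> Rel"
proof
  have eq: "form_relations A V n = pm.span (form_relators A V n)"
    unfolding form_relations_def
    by (rule module_span_free_module) (use form_relators_Free_deg carrier_free_forms in blast)
  show "form_relations A V n \<subseteq> Free_deg n \<inter> Rel"
    unfolding eq by (rule pm.span_minimal) (auto intro: form_relators_Free_deg Rel_base pm.subspace_inter)
  define pr :: "('a list \<Rightarrow>\<^sub>0 complex) \<Rightarrow> ('a list \<Rightarrow>\<^sub>0 complex)"
    where "pr = lin_ext (\<lambda>as. if length as = Suc n then basis as else 0)"
  have pr: "lin pr" unfolding pr_def by (rule lin_lin_ext)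
  have pr_id: "pr x = x" if "x \<in> Free_deg n" for x
  proof -
    have "pr x - x \<in> {0}"
      by (rule lin_Free_deg_into[OF lin_minus[OF pr lin_ident] pm.subspace_single_0 _ that])
        (auto simp: pr_def symbols_def)
    then show ?thesis by simp
  qed
  have pr_0: "pr x = 0" if "x \<in> Free_deg m" "m \<noteq> n" for x m
  proof -
    have "pr x \<in> {0}"
      by (rule lin_Free_deg_into[OF pr pm.subspace_single_0 _ that(1)])
        (use that(2) in \<open>auto simp: pr_def symbols_def\<close>)
    then show ?thesis by simp
  qed
  have pr_Rel: "pr x \<in> pm.span (form_relators A V n)" if "x \<in> Rel" for x
  proof (rule lin_span_into[OF pr pm.subspace_span _ that[unfolded Rel_def]])
    fix s assume "s \<in> (\<Union>n. form_relators A V n)"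
    then obtain m where m: "s \<in> form_relators A V m" by auto
    then show "pr s \<in> pm.span (form_relators A V n)"
      using pr_id pr_0 form_relators_Free_deg[OF m] by (cases "m = n") (auto intro: pm.span_base pm.span_zero)
  qed
  show "Free_deg n \<inter> Rel \<subseteq> form_relations A V n"
    unfolding eq using pr_Rel pr_id by force
qed

lemma submodule_form_relations: "submodule (form_relations A V n) complex_field (free_forms A n)"
  by (rule submodule_free_module) (auto simp: form_relations_eq intro: pm.subspace_inter)

definition form_class :: "nat \<Rightarrow> ('a list \<Rightarrow>\<^sub>0 complex) \<Rightarrow> ('a list \<Rightarrow>\<^sub>0 complex) set"
  where "form_class n x = form_relations A V n +>\<^bsub>free_forms A n\<^esub> x"

lemmas free_quot = module_free_module submodule_form_relations

lemma module_forms: "module complex_field (forms A V n)"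
  unfolding forms_def by (rule module_quot_module[OF free_quot])

lemma carrier_forms: "carrier (forms A V n) = form_class n ` Free_deg n"
  unfolding forms_def quot_module_carrier form_class_def by simp

lemma form_class_closed [simp]: "x \<in> Free_deg n \<Longrightarrow> form_class n x \<in> carrier (forms A V n)"
  by (simp add: carrier_forms)

lemma form_class_add: "x \<in> Free_deg n \<Longrightarrow> y \<in> Free_deg n \<Longrightarrow> form_class n x \<oplus>\<^bsub>forms A V n\<^esub> form_class n y = form_class n (x + y)"
  using quot_module_add[OF free_quot, of x n y] by (simp add: forms_def form_class_def)

lemma form_class_smult: "x \<in> Free_deg n \<Longrightarrow> c \<odot>\<^bsub>forms A V n\<^esub> form_class n x = form_class n (scale c x)"
  using quot_module_smult[OF free_quot, of c x n] by (simp add: forms_def form_class_def)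

lemma form_class_zero: "\<zero>\<^bsub>forms A V n\<^esub> = form_class n 0"
  using quot_module_zero[OF free_quot, of n] by (simp add: forms_def form_class_def)

lemma form_class_minus: "x \<in> Free_deg n \<Longrightarrow> y \<in> Free_deg n \<Longrightarrow> form_class n x \<ominus>\<^bsub>forms A V n\<^esub> form_class n y = form_class n (x - y)"
  using quot_module_minus[OF free_quot, of x n y] by (simp add: forms_def form_class_def)

lemma form_class_eq_iff: "x \<in> Free_deg n \<Longrightarrow> y \<in> Free_deg n \<Longrightarrow> form_class n x = form_class n y \<longleftrightarrow> x \<approx> y"
  using a_coset_eq_iff[OF free_quot, of x n y] by (simp add: form_class_def form_relations_eq eqv_def)

lemma mem_form_class: "x \<in> Free_deg n \<Longrightarrow> y \<in> form_class n x \<longleftrightarrow> y \<in> Free_deg n \<and> y \<approx> x"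
  by (auto simp: form_class_def a_r_coset_def' form_relations_eq eqv_def intro: exI[of _ "y - x"])
    (metis (no_types, lifting) Free_deg_closed(3) IntI diff_add_cancel)

lemma form_d_form_class: "x \<in> Free_deg n \<Longrightarrow> form_d A V n (form_class n x) = form_class (Suc n) (d_op x)"
  unfolding form_d_def form_class_def d_op_def[symmetric]
  by (rule induced_map_coset[OF free_quot free_quot])
    (auto simp: form_relations_eq lin_diff[OF lin_d_op, symmetric])

lemma contract_symbols:
  assumes "cs \<in> symbols A (Suc n)" "i \<le> n"
  shows "contract A i cs \<in> symbols A n"
proof -
  have "cs ! i \<in> carrier A" "cs ! Suc i \<in> carrier A"
    using assms by (auto simp: symbols_def intro!: subsetD[OF _ nth_mem])
  then show ?thesis
    using assms set_take_subset[of i cs] set_drop_subset[of "Suc (Suc i)" cs]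
    by (auto simp: symbols_def contract_def)
qed

lemma bilin_Free_deg:
  assumes x: "x \<in> Free_deg i" and y: "y \<in> Free_deg j"
  shows "bilin_ext (symbol_mult A) x y \<in> Free_deg (i + j)"
proof (rule lin_Free_deg_into[OF lin_bilin_ext_left subspace_Free_deg _ x])
  fix as assume as: "as \<in> symbols A i"
  show "bilin_ext (symbol_mult A) (basis as) y \<in> Free_deg (i + j)"
  proof (rule lin_Free_deg_into[OF lin_bilin_ext_right subspace_Free_deg _ y])
    fix bs assume bs: "bs \<in> symbols A j"
    have "as @ bs \<in> symbols A (Suc (i + j))"
      using as bs by (auto simp: symbols_def)
    then have "symbol_mult A as bs \<in> Free_deg (i + j)"
      unfolding symbol_mult_def Let_def using as
      by (intro pm.subspace_sum[OF subspace_Free_deg] pm.subspace_scale[OF subspace_Free_deg] basis_Free_deg contract_symbols)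
        (auto simp: symbols_def)
    then show "bilin_ext (symbol_mult A) (basis as) (basis bs) \<in> Free_deg (i + j)" by simp
  qed
qed

lemma prod_op_cong:
  assumes "x \<approx> x'" "y \<approx> y'" "x \<in> Free" "x' \<in> Free" "y \<in> Free" "y' \<in> Free"
  shows "prod_op x y \<approx> prod_op x' y'"
proof -
  have "prod_op x y - prod_op x' y \<in> Rel"
    using prod_op_Rel_left[OF assms(5), of "x - x'"] assms by (simp add: eqv_def lin_diff[OF lin_prod_op_left])
  moreover have "prod_op x' y - prod_op x' y' \<in> Rel"
    using prod_op_Rel_right[OF assms(4), of "y - y'"] assms by (simp add: eqv_def lin_diff[OF lin_prod_op_right])
  ultimately show ?thesis
    using eqv_trans[of "prod_op x y" "prod_op x' y" "prod_op x' y'"] by (simp add: eqv_def)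
qed

text \<open>Every pair of representatives yields the same class, since the alternating sum agrees
  with \<open>prod_op\<close> and \<open>prod_op\<close> respects congruence in both factors; hence
  the union is a single coset.\<close>

lemma form_mult_form_class:
  assumes x: "x \<in> Free_deg i" and y: "y \<in> Free_deg j"
  shows "form_mult A V i j (form_class i x) (form_class j y) = form_class (i + j) (prod_op x y)"
proof -
  have "form_class (i + j) (bilin_ext (symbol_mult A) x' y') = form_class (i + j) (prod_op x y)"
    if "x' \<in> form_class i x" "y' \<in> form_class j y" for x' y'
  proof -
    have x': "x' \<in> Free_deg i" "x' \<approx> x" and y': "y' \<in> Free_deg j" "y' \<approx> y"
      using that x y by (auto simp: mem_form_class)
    have "bilin_ext (symbol_mult A) x' y' \<approx> prod_op x' y'"
      using x' y' by (intro bilin_ext_symbol_mult_eqv Free_deg_Free)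
    also have "\<dots> \<approx> prod_op x y"
      using x y x' y' Free_deg_Free by (intro prod_op_cong) auto
    finally show ?thesis
      using x y x' y' by (subst form_class_eq_iff) (auto intro: bilin_Free_deg prod_op_Free_deg)
  qed
  moreover have "x \<in> form_class i x" "y \<in> form_class j y" using x y by (auto simp: mem_form_class)
  ultimately show ?thesis
    unfolding form_mult_def form_class_def[of "i + j", symmetric] by blast
qed

lemma scomm_Free_deg: "x \<in> Free_deg i \<Longrightarrow> y \<in> Free_deg j \<Longrightarrow> scomm i j x y \<in> Free_deg (i + j)"
  using prod_op_Free_deg[of x i y j] prod_op_Free_deg[of y j x i] by (simp add: scomm_def add.commute)

lemma supercommutator_form_class:
  assumes x: "x \<in> Free_deg i" and y: "y \<in> Free_deg j"
  shows "supercommutator A V i j (form_class i x) (form_class j y) = form_class (i + j) (scomm i j x y)"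
proof -
  have "prod_op y x \<in> Free_deg (i + j)" using prod_op_Free_deg[OF y x] by (simp add: add.commute)
  moreover have "form_mult A V j i (form_class j y) (form_class i x) = form_class (i + j) (prod_op y x)"
    using form_mult_form_class[OF y x] by (simp add: add.commute)
  ultimately show ?thesis
    using x y by (simp add: supercommutator_def form_mult_form_class form_class_smult form_class_minus prod_op_Free_deg scomm_def)
qed

lemma submodule_form_class_image:
  assumes "H \<subseteq> Free_deg n" "pm.subspace H"
  shows "submodule (form_class n ` H) complex_field (forms A V n)"
proof -
  interpret M: module complex_field "forms A V n" by (rule module_forms)
  have neg: "\<ominus>\<^bsub>forms A V n\<^esub> form_class n x = form_class n (- x)" if "x \<in> Free_deg n" for x
    by (rule M.M.minus_equality) (use that in \<open>auto simp: form_class_add form_class_zero\<close>)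
  show ?thesis
    by (rule M.submoduleI)
      (use assms in \<open>auto simp: form_class_zero subset_iff form_class_add form_class_smult neg carrier_forms pm.subspace_0
        pm.subspace_add pm.subspace_neg pm.subspace_scale intro!: imageI\<close>)
qed

text \<open>The characterisation of the hull: the image is a submodule containing the generators,
  and every such submodule contains the image.\<close>

lemma supercommutators_eq: "supercommutators A V n = form_class n ` (Free_deg n \<inter> Comm n)"
  unfolding supercommutators_def module_span_def
proof (rule hull_unique)
  show "(\<Union>i\<in>{0..n}. {supercommutator A V i (n - i) \<alpha> \<beta> | \<alpha> \<beta>.
        \<alpha> \<in> carrier (forms A V i) \<and> \<beta> \<in> carrier (forms A V (n - i))}) \<subseteq> form_class n ` (Free_deg n \<inter> Comm n)"
    using scomm_Free_deg scomm_Comm by (fastforce simp: carrier_forms supercommutator_form_class)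
  show "submodule (form_class n ` (Free_deg n \<inter> Comm n)) complex_field (forms A V n)"
    by (rule submodule_form_class_image) (auto intro: pm.subspace_inter)
next
  fix N
  assume sub: "(\<Union>i\<in>{0..n}. {supercommutator A V i (n - i) \<alpha> \<beta> | \<alpha> \<beta>.
        \<alpha> \<in> carrier (forms A V i) \<and> \<beta> \<in> carrier (forms A V (n - i))}) \<subseteq> N"
    and N: "submodule N complex_field (forms A V n)"
  \<comment> \<open>Pulling \<open>N\<close> back turns minimality among submodules of the quotient
    into minimality of a span in the free space.\<close>
  define H where "H = {x \<in> Free_deg n. form_class n x \<in> N}"
  have H: "pm.subspace H"
  proof (rule pm.subspaceI)
    show "0 \<in> H"
      using subgroup.one_closed[OF submodule.axioms(1)[OF N]] by (simp add: H_def form_class_zero)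
    show "x + y \<in> H" if "x \<in> H" "y \<in> H" for x y
      using module.submoduleE(5)[OF module_forms N] that by (auto simp: H_def form_class_add[symmetric])
    show "scale c x \<in> H" if "x \<in> H" for c x
      using submodule.smult_closed[OF N, of c "form_class n x"] that by (auto simp: H_def form_class_smult)
  qed
  have scH: "scomm i j x y \<in> H" if "i + j = n" "x \<in> Free_deg i" "y \<in> Free_deg j" for i j x y
  proof -
    have "supercommutator A V i (n - i) (form_class i x) (form_class (n - i) y) \<in> {supercommutator A V i (n - i) \<alpha> \<beta> | \<alpha> \<beta>.
        \<alpha> \<in> carrier (forms A V i) \<and> \<beta> \<in> carrier (forms A V (n - i))}"
      by (intro CollectI exI conjI, rule refl) (use that in auto)
    then have "supercommutator A V i (n - i) (form_class i x) (form_class (n - i) y) \<in> N"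
      using that by (intro subsetD[OF sub] UN_I[of i]) auto
    then show ?thesis
      using that scomm_Free_deg by (auto simp: H_def supercommutator_form_class)
  qed
  show "form_class n ` (Free_deg n \<inter> Comm n) \<subseteq> N"
  proof clarify
    fix x assume x: "x \<in> Free_deg n" "x \<in> Comm n"
    then obtain r s where rs: "x = r + s" "r \<in> Rel"
        "s \<in> pm.span {scomm i j x y | i j x y. i + j = n \<and> x \<in> Free_deg i \<and> y \<in> Free_deg j}"
      unfolding Comm_def pm.span_Un by (auto simp: pm.span_eq_iff[THEN iffD2])
    have "s \<in> H"
      by (rule subsetD[OF pm.span_minimal[OF _ H] rs(3)]) (use scH in auto)
    \<comment> \<open>A priori \<open>r\<close> is a relation of mixed degree. As the difference of
      \<open>x\<close> and \<open>s\<close> it has degree \<open>n\<close>, so its class is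
      zero.\<close>
    moreover have "r \<in> H"
    proof -
      have "r = x - s" using rs by simp
      then have "r \<in> Free_deg n" using x \<open>s \<in> H\<close> by (simp add: H_def)
      then have "form_class n r = form_class n 0" using rs by (simp add: form_class_eq_iff eqv_def)
      then show ?thesis using \<open>r \<in> Free_deg n\<close> pm.subspace_0[OF H] by (simp add: H_def)
    qed
    ultimately show "form_class n x \<in> N" using rs pm.subspace_add[OF H] by (auto simp: H_def)
  qed
qed

lemma submodule_supercommutators: "submodule (supercommutators A V n) complex_field (forms A V n)"
  unfolding supercommutators_eq by (rule submodule_form_class_image) (auto intro: pm.subspace_inter)

definition dR_class :: "nat \<Rightarrow> ('a list \<Rightarrow>\<^sub>0 complex) \<Rightarrow> ('a list \<Rightarrow>\<^sub>0 complex) set set"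
  where "dR_class n x = supercommutators A V n +>\<^bsub>forms A V n\<^esub> form_class n x"

lemmas form_quot = module_forms submodule_supercommutators

lemma module_dR: "module complex_field (dR A V n)"
  unfolding dR_def by (rule module_quot_module[OF form_quot])

lemma carrier_dR: "carrier (dR A V n) = dR_class n ` Free_deg n"
  unfolding dR_def quot_module_carrier carrier_forms dR_class_def by auto

lemma dR_class_closed [simp]: "x \<in> Free_deg n \<Longrightarrow> dR_class n x \<in> carrier (dR A V n)"
  by (simp add: carrier_dR)

lemma dR_class_add: "x \<in> Free_deg n \<Longrightarrow> y \<in> Free_deg n \<Longrightarrow> dR_class n x \<oplus>\<^bsub>dR A V n\<^esub> dR_class n y = dR_class n (x + y)"
  using quot_module_add[OF form_quot, of "form_class n x" n "form_class n y"] by (simp add: dR_def dR_class_def form_class_add)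

lemma dR_class_smult: "x \<in> Free_deg n \<Longrightarrow> c \<odot>\<^bsub>dR A V n\<^esub> dR_class n x = dR_class n (scale c x)"
  using quot_module_smult[OF form_quot, of c "form_class n x" n] by (simp add: dR_def dR_class_def form_class_smult)

lemma dR_class_zero: "\<zero>\<^bsub>dR A V n\<^esub> = dR_class n 0"
  using quot_module_zero[OF form_quot, of n] by (simp add: dR_def dR_class_def form_class_zero)

lemma form_class_mem_supercommutators: "x \<in> Free_deg n \<Longrightarrow> form_class n x \<in> supercommutators A V n \<longleftrightarrow> x \<in> Comm n"
  by (auto simp: supercommutators_eq form_class_eq_iff intro: eqv_Comm)

lemma dR_class_eq_iff: "x \<in> Free_deg n \<Longrightarrow> y \<in> Free_deg n \<Longrightarrow> dR_class n x = dR_class n y \<longleftrightarrow> x - y \<in> Comm n"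
  using a_coset_eq_iff[OF form_quot, of "form_class n x" n "form_class n y"]
  by (simp add: dR_class_def form_class_minus form_class_mem_supercommutators)

lemma dR_d_dR_class:
  assumes "x \<in> Free_deg n"
  shows "dR_d A V n (dR_class n x) = dR_class (Suc n) (d_op x)"
proof -
  have "dR_d A V n (dR_class n x) = supercommutators A V (Suc n) +>\<^bsub>forms A V (Suc n)\<^esub> form_d A V n (form_class n x)"
    unfolding dR_d_def dR_class_def
  proof (rule induced_map_coset[OF form_quot form_quot])
    fix \<alpha> \<beta>
    assume "\<alpha> \<in> carrier (forms A V n)" "\<beta> \<in> carrier (forms A V n)"
      and *: "\<alpha> \<ominus>\<^bsub>forms A V n\<^esub> \<beta> \<in> supercommutators A V n"
    then obtain x y where x: "\<alpha> = form_class n x" "x \<in> Free_deg n" and y: "\<beta> = form_class n y" "y \<in> Free_deg n"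
      by (auto simp: carrier_forms)
    then have "d_op (x - y) \<in> Comm (Suc n)"
      using * by (intro d_op_Comm) (simp add: form_class_minus form_class_mem_supercommutators)
    then show "form_d A V n \<alpha> \<ominus>\<^bsub>forms A V (Suc n)\<^esub> form_d A V n \<beta> \<in> supercommutators A V (Suc n)"
      using x y by (simp add: form_d_form_class form_class_minus form_class_mem_supercommutators lin_diff[OF lin_d_op])
  qed (use assms in \<open>auto simp: carrier_forms form_d_form_class\<close>)
  then show ?thesis using assms by (simp add: form_d_form_class dR_class_def)
qed

end

section \<open>Acyclicity of the Karoubi complex\<close>

context euler_derivation begin

theorem dR_acyclic: "dR_acyclic A V"
  unfolding dR_acyclic_def
proof (intro conjI allI impI)
  have lin_d: "dR_d A V n \<in> linear_maps complex_field (dR A V n) (dR A V (Suc n))" for n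
    by (auto simp: linear_maps_def carrier_dR dR_d_dR_class dR_class_add dR_class_smult lin_add[OF lin_d_op] lin_scale[OF lin_d_op])
  show "cochain_complex complex_field (dR A V) (dR_d A V)"
    unfolding cochain_complex_def
    by (auto simp: module_dR lin_d carrier_dR dR_d_dR_class dR_class_zero dR_class_eq_iff d_op_d_op Free_deg_Free)
  have mem_cocycles: "dR_class n x \<in> carrier (cocycles (dR A V) (dR_d A V) n) \<longleftrightarrow> d_op x \<in> Comm (Suc n)"
    if "x \<in> Free_deg n" for n x
    using that by (simp add: cocycles_def dR_d_dR_class dR_class_zero dR_class_eq_iff)
  have cocyclesE: "\<exists>x\<in>Free_deg n. \<omega> = dR_class n x \<and> d_op x \<in> Comm (Suc n)"
    if "\<omega> \<in> carrier (cocycles (dR A V) (dR_d A V) n)" for n \<omega>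
    using that mem_cocycles by (fastforce simp: cocycles_def carrier_dR)
  show "carrier (dR_cohomology A V n) = {\<zero>\<^bsub>dR_cohomology A V n\<^esub>}" if n: "1 \<le> n" for n
  proof -
    obtain m where m: "n = Suc m" using n by (cases n) auto
    let ?Z = "cocycles (dR A V) (dR_d A V) n" and ?B = "coboundaries (dR A V) (dR_d A V) n"
    have B: "?B = (\<lambda>y. dR_class n (d_op y)) ` Free_deg m"
      by (auto simp: coboundaries_def m carrier_dR dR_d_dR_class image_iff)
    \<comment> \<open>By exactness each cocycle is a coboundary, and translation by a coboundary
      permutes the coboundaries.\<close>
    have "?B +>\<^bsub>?Z\<^esub> \<omega> = ?B" if Z: "\<omega> \<in> carrier ?Z" for \<omega>
    proof -
      obtain x where x: "x \<in> Free_deg n" "\<omega> = dR_class n x" "d_op x \<in> Comm (Suc n)"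
        using cocyclesE[OF Z] by auto
      obtain y where y: "y \<in> Free_deg m" "x - d_op y \<in> Comm n"
        using exact_pos[of x m] x by (auto simp: m)
      have \<omega>: "\<omega> = dR_class n (d_op y)" using x y by (simp add: m dR_class_eq_iff)
      have "?B +>\<^bsub>?Z\<^esub> \<omega> = (\<lambda>z. dR_class n (d_op (z + y))) ` Free_deg m"
        using y by (auto simp: a_r_coset_def' cocycles_def B[unfolded m] \<omega> m dR_class_add lin_add[OF lin_d_op])
      also have "\<dots> = ?B"
      proof -
        have "(\<lambda>z. z + y) ` Free_deg m = Free_deg m"
        proof (intro equalityI subsetI)
          fix z assume "z \<in> Free_deg m"
          then show "z \<in> (\<lambda>z. z + y) ` Free_deg m"
            using y by (intro image_eqI[of _ _ "z - y"]) auto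
        qed (use y in auto)
        then show ?thesis
          unfolding B by (metis image_image)
      qed
      finally show ?thesis .
    qed
    \<comment> \<open>With at least one cocycle the set of cosets is a singleton rather than
      empty.\<close>
    moreover have "carrier ?Z \<noteq> {}"
      using mem_cocycles[of 0 n] by (auto simp: lin_zero[OF lin_d_op])
    ultimately show ?thesis
      by (auto simp: dR_cohomology_def cohomology_def quot_module_def A_RCOSETS_def')
  qed
  show "dR_unit A V \<in> linear_isos complex_field (A\<lparr>carrier := V\<rparr>) (dR_cohomology A V 0)"
  proof -
    let ?Z = "cocycles (dR A V) (dR_d A V) 0" and ?H = "dR_cohomology A V 0"
    have v0: "basis [v] \<in> Free_deg 0" if "v \<in> V" for v
      using that by (auto simp: symbols_def)
    \<comment> \<open>The coboundaries in degree 0 are the zero class alone, so cohomology classes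
      are singletons and can be computed by their element.\<close>
    have coset: "{dR_class 0 0} +>\<^bsub>?Z\<^esub> dR_class 0 x = {dR_class 0 x}" "{dR_class 0 0} +>\<^bsub>dR A V 0\<^esub> dR_class 0 x = {dR_class 0 x}"
      if "x \<in> Free_deg 0" for x
      using that by (auto simp: a_r_coset_def' cocycles_def dR_class_add)
    have B: "coboundaries (dR A V) (dR_d A V) 0 = {dR_class 0 0}"
      by (simp add: coboundaries_def dR_class_zero)
    have unit: "dR_unit A V v = {dR_class 0 (basis [v])}" if "v \<in> V" for v
      unfolding dR_unit_def B form_class_def[symmetric] dR_class_def[symmetric] using v0[OF that] by (rule coset)
    \<comment> \<open>The differential of \<open>v\<close> is the symbol \<open>[\<one>, v]\<close>,
      a relation.\<close>
    have cocycle: "dR_class 0 (basis [v]) \<in> carrier ?Z" if "v \<in> V" for v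
      using relator_V[of "[\<one>]" "[]" v] that v0 by (simp add: mem_cocycles)
    have carr: "carrier ?H = (\<lambda>\<omega>. {\<omega>}) ` carrier ?Z"
    proof -
      have "{dR_class 0 0} +>\<^bsub>?Z\<^esub> \<omega> = {\<omega>}" if "\<omega> \<in> carrier ?Z" for \<omega>
        using cocyclesE[OF that] coset(1) by auto
      then show ?thesis
        by (auto simp: dR_cohomology_def cohomology_def quot_module_carrier B)
    qed
    have add: "{dR_class 0 x} \<oplus>\<^bsub>?H\<^esub> {dR_class 0 y} = {dR_class 0 (x + y)}" if "x \<in> Free_deg 0" "y \<in> Free_deg 0" for x y
      using that by (simp add: dR_cohomology_def cohomology_def quot_module_def set_add_def' cocycles_def dR_class_add)
    have smult: "c \<odot>\<^bsub>?H\<^esub> {dR_class 0 x} = {dR_class 0 (scale c x)}" if "x \<in> Free_deg 0" for c x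
      using that coset(1)[of "scale c x"]
      by (simp add: dR_cohomology_def cohomology_def quot_module_def B) (simp add: cocycles_def dR_class_smult)
    have "dR_unit A V (u \<oplus> v) = dR_unit A V u \<oplus>\<^bsub>?H\<^esub> dR_unit A V v" if "u \<in> V" "v \<in> V" for u v
    proof -
      have "basis [u \<oplus> v] - (basis [u] + basis [v]) \<in> Comm 0"
        using relator_add[of "[]" "[]" u v] that by (simp add: eqv_def)
      then show ?thesis
        using that v0 V_add by (simp add: unit add dR_class_eq_iff)
    qed
    moreover have "dR_unit A V (c \<odot> v) = c \<odot>\<^bsub>?H\<^esub> dR_unit A V v" if "v \<in> V" for c v
    proof -
      have "basis [c \<odot> v] - scale c (basis [v]) \<in> Comm 0"
        using relator_smult[of "[]" "[]" v c] that by (simp add: eqv_def)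
      then show ?thesis
        using that v0[of v] v0[of "c \<odot> v"] V_smult
        by (simp add: unit smult dR_class_eq_iff Free_deg_closed(5)[OF v0] del: scale_single)
    qed
    moreover have "inj_on (dR_unit A V) V"
    proof (rule inj_onI)
      fix u v assume uv: "u \<in> V" "v \<in> V" "dR_unit A V u = dR_unit A V v"
      \<comment> \<open>The difference of \<open>u\<close> and \<open>v\<close>, written with the
        two operations under which \<open>V\<close> is known to be closed.\<close>
      let ?w = "u \<oplus> (- 1) \<odot> v"
      have w: "?w \<in> V" using uv V_add V_smult by auto
      have "basis [u] - basis [v] \<in> Comm 0"
        using uv v0 by (simp add: unit dR_class_eq_iff)
      moreover have "basis [?w] \<approx> basis [u] - basis [v]"
      proof -
        have "basis [?w] \<approx> basis [u] + basis [(- 1) \<odot> v]"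
          using relator_add[of "[]" "[]" u "(- 1) \<odot> v"] uv by simp
        also have "\<dots> \<approx> basis [u] + scale (- 1) (basis [v])"
          using relator_smult[of "[]" "[]" v "- 1"] uv by (intro eqv_add eqv_refl) simp
        finally show ?thesis by (simp add: single_uminus)
      qed
      ultimately have "?w = \<zero>"
        using V_inter_Comm_0[OF w] eqv_Comm by blast
      moreover have "(- 1) \<odot> v = \<ominus> v"
      proof -
        have "(- 1) \<odot> v \<oplus> v = (- 1 + 1) \<odot> v"
          using module.smult_l_distr[OF module_A, of "- 1" 1 v] module.smult_one[OF module_A, of v] uv
          by (simp add: ring_of_type_algebra_def)
        then have "(- 1) \<odot> v \<oplus> v = \<zero>" using uv by (simp add: zero_smult)
        then show ?thesis using uv by (intro minus_equality[symmetric]) auto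
      qed
      ultimately show "u = v"
        using uv by (metis V_carrier a_inv_closed minus_equality minus_minus)
    qed
    moreover have "dR_unit A V ` V = carrier ?H"
    proof (intro equalityI subsetI)
      fix \<xi> assume "\<xi> \<in> dR_unit A V ` V"
      then show "\<xi> \<in> carrier ?H" using cocycle by (auto simp: unit carr)
    next
      fix \<xi> assume "\<xi> \<in> carrier ?H"
      then obtain x where x: "\<xi> = {dR_class 0 x}" "x \<in> Free_deg 0" "d_op x \<in> Comm 1"
        using cocyclesE[of _ 0] by (auto simp: carr)
      then obtain v where v: "v \<in> V" "x - basis [v] \<in> Comm 0" using exact_0 by blast
      then have "\<xi> = dR_unit A V v" using x v0 by (simp add: unit dR_class_eq_iff)
      then show "\<xi> \<in> dR_unit A V ` V" using v by auto
    qed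
    ultimately show ?thesis
      by (auto simp: linear_isos_def linear_maps_def bij_betw_def)
  qed
qed

end

section \<open>The path algebra\<close>

lemma lin_eq_on:
  assumes "lin f" "lin g" "\<And>x. x \<in> S \<Longrightarrow> f (basis x) = g (basis x)" "y \<in> pm.span (basis ` S)"
  shows "f y = g y"
proof -
  have "f y - g y \<in> {0}"
    by (rule lin_span_into[OF lin_minus[OF assms(1,2)] pm.subspace_single_0 _ assms(4)]) (use assms(3) in auto)
  then show ?thesis by simp
qed

text \<open>\<open>path_mult\<close> is defined on all triples, so associativity and the Euler
  derivation rule can be checked on the whole type before restricting to a quiver.\<close>

lemma span_basis_UNIV: "x \<in> pm.span (basis ` UNIV)"
  using free_eq_span[of UNIV] by auto

lemmas bilin_ext_linear =
  lin_add[OF lin_bilin_ext_left] lin_add[OF lin_bilin_ext_right]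
  lin_diff[OF lin_bilin_ext_left] lin_diff[OF lin_bilin_ext_right]
  lin_scale[OF lin_bilin_ext_left] lin_scale[OF lin_bilin_ext_right]
  lin_zero[OF lin_bilin_ext_left] lin_zero[OF lin_bilin_ext_right]

abbreviation path_product ::
    "(('v, 'e) path \<Rightarrow>\<^sub>0 complex) \<Rightarrow> (('v, 'e) path \<Rightarrow>\<^sub>0 complex) \<Rightarrow> (('v, 'e) path \<Rightarrow>\<^sub>0 complex)"
  where "path_product \<equiv> bilin_ext path_mult"

lemma path_mult_assoc:
  "path_product (path_mult p q) (basis r) = path_product (basis p) (path_mult q r)"
  by (cases p; cases q; cases r) (simp add: bilin_ext_linear)

lemma path_product_assoc:
  "path_product (path_product f g) h = path_product f (path_product g h)"
proof (rule lin_eq_on[OF _ _ _ span_basis_UNIV[of f]])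
  fix p
  show "path_product (path_product (basis p) g) h = path_product (basis p) (path_product g h)"
  proof (rule lin_eq_on[OF _ _ _ span_basis_UNIV[of g]])
    fix q
    show "path_product (path_product (basis p) (basis q)) h = path_product (basis p) (path_product (basis q) h)"
      by (rule lin_eq_on[OF _ _ _ span_basis_UNIV[of h]])
        (simp_all add: path_mult_assoc lin_bilin_ext_right lin_comp[OF lin_bilin_ext_right lin_bilin_ext_right])
  qed (rule lin_comp[OF lin_bilin_ext_left lin_bilin_ext_right] lin_comp[OF lin_bilin_ext_right lin_bilin_ext_left])+
qed (rule lin_comp[OF lin_bilin_ext_left lin_bilin_ext_left] lin_bilin_ext_left)+

definition euler :: "(('v, 'e) path \<Rightarrow>\<^sub>0 complex) \<Rightarrow> (('v, 'e) path \<Rightarrow>\<^sub>0 complex)"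
  where "euler = lin_ext (\<lambda>p. scale (of_nat (length (fst (snd p)))) (basis p))"

lemma lin_euler: "lin euler"
  by (simp add: euler_def lin_lin_ext)

lemma euler_basis: "euler (basis p) = scale (of_nat (length (fst (snd p)))) (basis p)"
  by (simp add: euler_def del: scale_single)

text \<open>Lengths add under concatenation; for paths that do not compose all terms vanish.\<close>

lemma euler_path_mult:
  "euler (path_mult p q) = path_product (euler (basis p)) (basis q) + path_product (basis p) (euler (basis q))"
  by (cases p; cases q)
    (simp add: euler_basis bilin_ext_linear lin_zero[OF lin_euler] pm.scale_left_distrib[symmetric] del: scale_single)

lemma euler_product: "euler (path_product f g) = path_product (euler f) g + path_product f (euler g)"
proof (rule lin_eq_on[OF _ _ _ span_basis_UNIV[of f]])
  fix p
  show "euler (path_product (basis p) g) = path_product (euler (basis p)) g + path_product (basis p) (euler g)"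
    by (rule lin_eq_on[OF _ _ _ span_basis_UNIV[of g]])
      (auto intro: lin_plus lin_comp[OF lin_euler lin_bilin_ext_right] lin_comp[OF lin_bilin_ext_right lin_euler]
        lin_bilin_ext_right simp: euler_path_mult)
qed (auto intro: lin_plus lin_comp[OF lin_euler lin_bilin_ext_left] lin_comp[OF lin_bilin_ext_left lin_euler]
        lin_bilin_ext_left)

lemma carrier_path_algebra: "carrier (path_algebra Q) = pm.span (basis ` quiver_paths Q)"
  by (simp add: path_algebra_def free_eq_span)

lemma path_algebra_simps [simp]:
  "f \<oplus>\<^bsub>path_algebra Q\<^esub> g = f + g" "f \<otimes>\<^bsub>path_algebra Q\<^esub> g = path_product f g"
  "\<zero>\<^bsub>path_algebra Q\<^esub> = 0" "c \<odot>\<^bsub>path_algebra Q\<^esub> f = scale c f"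
  "\<one>\<^bsub>path_algebra Q\<^esub> = (\<Sum>v\<in>verts Q. basis (v, [], v))"
  by (simp_all add: path_algebra_def)

lemma vertex_subalgebra_eq: "vertex_subalgebra Q = pm.span (basis ` (\<lambda>v. (v, [], v)) ` verts Q)"
  by (simp add: vertex_subalgebra_def free_eq_span)

section \<open>The path algebra of a finite quiver as an instance\<close>

context fin_digraph begin

lemma path_product_closed:
  assumes f: "f \<in> carrier (path_algebra G)" and g: "g \<in> carrier (path_algebra G)"
  shows "path_product f g \<in> carrier (path_algebra G)"
  unfolding carrier_path_algebra
proof (rule lin_span_into[OF lin_bilin_ext_left pm.subspace_span _ f[unfolded carrier_path_algebra]], clarify)
  fix u es w assume p: "(u, es, w) \<in> quiver_paths G"
  show "path_product (basis (u, es, w)) g \<in> pm.span (basis ` quiver_paths G)"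
  proof (rule lin_span_into[OF lin_bilin_ext_right pm.subspace_span _ g[unfolded carrier_path_algebra]], clarify)
    fix u' es' w' assume q: "(u', es', w') \<in> quiver_paths G"
    show "path_product (basis (u, es, w)) (basis (u', es', w')) \<in> pm.span (basis ` quiver_paths G)"
      using p q by (auto simp: quiver_paths_def intro!: pm.span_base pm.span_zero imageI)
  qed
qed

lemma path_algebra_unit:
  assumes f: "f \<in> carrier (path_algebra G)"
  shows "path_product (\<Sum>v\<in>verts G. basis (v, [], v)) f = f"
    and "path_product f (\<Sum>v\<in>verts G. basis (v, [], v)) = f"
proof -
  have sum_l: "path_product (\<Sum>v\<in>verts G. basis (v, [], v)) f = (\<Sum>v\<in>verts G. path_product (basis (v, [], v)) f)" for f
    by (rule module_hom.sum[OF lin_bilin_ext_left])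
  have sum_r: "path_product f (\<Sum>v\<in>verts G. basis (v, [], v)) = (\<Sum>v\<in>verts G. path_product f (basis (v, [], v)))" for f
    by (rule module_hom.sum[OF lin_bilin_ext_right])
  show "path_product (\<Sum>v\<in>verts G. basis (v, [], v)) f = f"
    by (rule lin_eq_on[OF lin_bilin_ext_right lin_ident _ f[unfolded carrier_path_algebra]])
      (auto simp: sum_l quiver_paths_def sum.delta dest: awalk_hd_in_verts)
  show "path_product f (\<Sum>v\<in>verts G. basis (v, [], v)) = f"
    by (rule lin_eq_on[OF lin_bilin_ext_left lin_ident _ f[unfolded carrier_path_algebra]])
      (auto simp: sum_r quiver_paths_def sum.delta' dest: awalk_last_in_verts)
qed

text \<open>The source of the traces. If either path has an arrow, neither product has a term of
  length zero; two paths of length zero are vertex idempotents and commute.\<close>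

lemma lookup_path_product_commute:
  assumes f: "f \<in> carrier (path_algebra G)" and g: "g \<in> carrier (path_algebra G)"
  shows "Poly_Mapping.lookup (path_product f g) (u, [], u) = Poly_Mapping.lookup (path_product g f) (u, [], u)"
proof -
  define T :: "(('a, 'b) path \<Rightarrow>\<^sub>0 complex) set" where "T = {h. Poly_Mapping.lookup h (u, [], u) = 0}"
  have T: "pm.subspace T"
    by (rule pm.subspaceI) (auto simp: T_def lookup_add)
  have "path_product f g - path_product g f \<in> T"
  proof (rule lin_span_into[OF lin_minus[OF lin_bilin_ext_left lin_bilin_ext_right] T _ f[unfolded carrier_path_algebra]], clarify)
    fix a es b assume p: "(a, es, b) \<in> quiver_paths G"
    show "path_product (basis (a, es, b)) g - path_product g (basis (a, es, b)) \<in> T"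
    proof (rule lin_span_into[OF lin_minus[OF lin_bilin_ext_right lin_bilin_ext_left] T _ g[unfolded carrier_path_algebra]], clarify)
      fix a' es' b' assume q: "(a', es', b') \<in> quiver_paths G"
      show "path_product (basis (a, es, b)) (basis (a', es', b')) - path_product (basis (a', es', b')) (basis (a, es, b)) \<in> T"
        using p q by (cases es; cases es')
          (auto simp: T_def lookup_minus lookup_single when_def quiver_paths_def awalk_Nil_iff)
    qed
  qed
  then show ?thesis by (simp add: T_def lookup_minus)
qed

lemma vertex_subalgebra_subset: "vertex_subalgebra G \<subseteq> carrier (path_algebra G)"
  unfolding vertex_subalgebra_eq carrier_path_algebra
  by (rule pm.span_mono) (auto simp: quiver_paths_def awalk_Nil_iff)

lemma one_in_vertex_subalgebra: "(\<Sum>v\<in>verts G. basis (v, [], v)) \<in> vertex_subalgebra G"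
  unfolding vertex_subalgebra_eq by (intro pm.span_sum pm.span_base) auto

lemma abelian_group_path_algebra: "abelian_group (path_algebra G)"
proof (rule abelian_groupI)
  fix f assume "f \<in> carrier (path_algebra G)"
  then show "\<exists>g\<in>carrier (path_algebra G). g \<oplus>\<^bsub>path_algebra G\<^esub> f = \<zero>\<^bsub>path_algebra G\<^esub>"
    by (intro bexI[of _ "- f"]) (auto simp: carrier_path_algebra intro: pm.span_neg)
qed (auto simp: carrier_path_algebra algebra_simps intro: pm.span_add pm.span_zero)

lemma ring_path_algebra: "ring (path_algebra G)"
proof (rule ringI[OF abelian_group_path_algebra])
  show "monoid (path_algebra G)"
    using subsetD[OF vertex_subalgebra_subset one_in_vertex_subalgebra]
    by (intro monoidI) (auto simp: path_product_closed path_product_assoc path_algebra_unit)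
qed (auto simp: bilin_ext_linear)

lemma module_path_algebra: "module complex_field (path_algebra G)"
proof (rule moduleI[OF _ abelian_group_path_algebra])
  show "cring (complex_field :: complex ring)" by (rule cring_from_type_algebra)
qed (auto simp: carrier_path_algebra ring_of_type_algebra_def pm.scale_left_distrib pm.scale_right_distrib
    intro: pm.span_scale)

text \<open>On a basis vector the sum over the support has a single term, the length of the
  path.\<close>

sublocale euler_derivation "path_algebra G" "vertex_subalgebra G" euler "basis ` quiver_paths G"
  "\<lambda>f. \<Sum>p\<in>Poly_Mapping.keys f. length (fst (snd p))"
proof (intro euler_derivation.intro relative_derivation.intro relative_algebra.intro
    relative_derivation_axioms.intro euler_derivation_axioms.intro)
  show "ring (path_algebra G)" by (rule ring_path_algebra)
  show "module complex_field (path_algebra G)" by (rule module_path_algebra)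
  show "vertex_subalgebra G \<subseteq> carrier (path_algebra G)" by (rule vertex_subalgebra_subset)
  show "\<one>\<^bsub>path_algebra G\<^esub> \<in> vertex_subalgebra G" by (simp add: one_in_vertex_subalgebra)
  show "basis ` quiver_paths G \<subseteq> carrier (path_algebra G)"
    by (simp add: carrier_path_algebra pm.span_superset)
  show "euler f \<in> carrier (path_algebra G)" if "f \<in> carrier (path_algebra G)" for f
    unfolding carrier_path_algebra
    by (rule lin_span_into[OF lin_euler pm.subspace_span _ that[unfolded carrier_path_algebra]])
      (clarify, unfold euler_basis, intro pm.span_scale pm.span_base imageI)
  show "euler v = \<zero>\<^bsub>path_algebra G\<^esub>" if "v \<in> vertex_subalgebra G" for v
  proof -
    have "euler v \<in> {0}"
      by (rule lin_span_into[OF lin_euler pm.subspace_single_0 _ that[unfolded vertex_subalgebra_eq]])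
        (auto simp: euler_basis)
    then show ?thesis by simp
  qed
  show "b \<in> vertex_subalgebra G"
    if "b \<in> basis ` quiver_paths G" "(\<Sum>p\<in>Poly_Mapping.keys b. length (fst (snd p))) = 0" for b
    using that unfolding vertex_subalgebra_eq
    by (intro pm.span_base) (auto simp: quiver_paths_def awalk_Nil_iff)
  show "Pr a"
    if a: "a \<in> carrier (path_algebra G)" and "Pr \<zero>\<^bsub>path_algebra G\<^esub>" "\<And>b. b \<in> basis ` quiver_paths G \<Longrightarrow> Pr b"
      "\<And>a b. a \<in> carrier (path_algebra G) \<Longrightarrow> b \<in> carrier (path_algebra G) \<Longrightarrow> Pr a \<Longrightarrow> Pr b \<Longrightarrow> Pr (a \<oplus>\<^bsub>path_algebra G\<^esub> b)"
      "\<And>c a. a \<in> carrier (path_algebra G) \<Longrightarrow> Pr a \<Longrightarrow> Pr (c \<odot>\<^bsub>path_algebra G\<^esub> a)" for a Pr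
  proof -
    \<comment> \<open>The induction rule \<open>B_span\<close> is minimality of the span of the
      paths. Intersecting with the carrier makes the closure hypotheses on \<open>Pr\<close>
      applicable.\<close>
    have sub: "pm.subspace {a \<in> carrier (path_algebra G). Pr a}"
      using that(2,4,5) by (intro pm.subspaceI) (auto simp: carrier_path_algebra intro: pm.span_zero pm.span_add pm.span_scale)
    have "carrier (path_algebra G) \<subseteq> {a \<in> carrier (path_algebra G). Pr a}"
      using that(3) pm.span_base[of _ "basis ` quiver_paths G"]
      by (subst carrier_path_algebra) (rule pm.span_minimal[OF _ sub], auto simp: carrier_path_algebra)
    then show ?thesis using a by auto
  qed
  show "\<exists>\<chi> :: (('a, 'b) path \<Rightarrow>\<^sub>0 complex) \<Rightarrow> complex. \<chi> v \<noteq> 0 \<and>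
      (\<forall>a\<in>carrier (path_algebra G). \<forall>b\<in>carrier (path_algebra G).
        \<chi> (a \<oplus>\<^bsub>path_algebra G\<^esub> b) = \<chi> a + \<chi> b \<and> \<chi> (a \<otimes>\<^bsub>path_algebra G\<^esub> b) = \<chi> (b \<otimes>\<^bsub>path_algebra G\<^esub> a)) \<and>
      (\<forall>c. \<forall>a\<in>carrier (path_algebra G). \<chi> (c \<odot>\<^bsub>path_algebra G\<^esub> a) = c * \<chi> a)"
    if v: "v \<in> vertex_subalgebra G" "v \<noteq> \<zero>\<^bsub>path_algebra G\<^esub>" for v
  proof -
    \<comment> \<open>A nonzero element of \<open>V\<close> has a nonzero coefficient at some vertex
      idempotent; taking that coefficient is the required trace.\<close>
    obtain p where p: "Poly_Mapping.lookup v p \<noteq> 0"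
      using v(2) by (metis lookup_zero path_algebra_simps(3) poly_mapping_eqI)
    then have "p \<in> Poly_Mapping.keys v" by (simp add: in_keys_iff)
    then obtain u where "p = (u, [], u)"
      using v(1) by (auto simp: vertex_subalgebra_def)
    with p show ?thesis
      by (intro exI[of _ "\<lambda>a. Poly_Mapping.lookup a (u, [], u)"])
        (auto simp: lookup_add lookup_path_product_commute)
  qed
qed (auto simp: bilin_ext_linear lin_add[OF lin_euler] lin_scale[OF lin_euler] euler_product euler_basis
    vertex_subalgebra_eq intro: pm.span_add pm.span_scale simp del: scale_single)

end

theorem theorem3p6:
  fixes Q :: "('v, 'e) pre_digraph"
    and A :: "(complex, ('v, 'e) path \<Rightarrow>\<^sub>0 complex) module"
    and V :: "(('v, 'e) path \<Rightarrow>\<^sub>0 complex) set"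
  assumes "fin_digraph Q"
  defines "A \<equiv> path_algebra Q" and "V \<equiv> vertex_subalgebra Q"
  shows "dR_acyclic A V
    \<and> modules_isomorphic complex_field (dR_cohomology A V 0) (A\<lparr>carrier := V\<rparr>)
    \<and> (\<forall>n\<ge>1. carrier (dR_cohomology A V n) = {\<zero>\<^bsub>dR_cohomology A V n\<^esub>})"
proof -
  interpret fin_digraph Q by (rule assms(1))
  have acyclic: "dR_acyclic A V"
    unfolding A_def V_def by (rule dR_acyclic)
  then have "the_inv_into (carrier (A\<lparr>carrier := V\<rparr>)) (dR_unit A V)
      \<in> linear_isos complex_field (dR_cohomology A V 0) (A\<lparr>carrier := V\<rparr>)"
    using V_add V_smult by (intro linear_isos_inv) (auto simp: dR_acyclic_def A_def V_def)
  with acyclic show ?thesis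
    by (auto simp: dR_acyclic_def modules_isomorphic_def)
qed

end
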